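(* Let $\alpha\in(0,1)$, $r>0$, let $S=(S_t)_{t=0,\dots,T}$ be a nonnegative adapted stock price process, and assume that for all $t=1,\dots,T$ $$P(S_{t-1}=0,\ S_t>0)=0\qquad\text{and}\qquad P\left(\frac{S_t-S_{t-1}}{S_{t-1}}\le (1-\alpha)r\ \Big|\ \mathcal{F}_{t-1}\right)>0\quad P\text{-a.s.},$$ with the convention $0/0:=0$. Then: (i) The set of attainable terminal wealths $$\mathcal{A}:=\{\eta_T\in L^0(\Omega,\mathcal{F},P)\ |\ (\eta,N)\ \text{self-financing for zero initial capital}\} - L^0_+(\Omega,\mathcal{F},P)$$ is closed with respect to convergence in probability. (ii) There exists a probability measure $Q\sim P$ with bounded density $dQ/dP$ such that $E_Q(S_i)<\infty$ for all $i=0,1,\ldots,T$ and $$E_Q\left(\frac{S_{\tau} - \alpha(S_{\tau}-S_i)}{(1+(1-\alpha)r)^{\tau}}\right) \le E_Q\left(\frac{S_i}{(1+(1-\alpha)r)^i}\right)\quad \text{for all } i=0,\ldots,T-1,\ \tau\in\mathcal{T}_i,$$ where $\mathcal{T}_i$ denotes the set of $\{i,\ldots,T\}$-valued stopping times.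
   Context: Setting. Fix $T\in\mathbb{N}=\{1,2,\dots\}$ and a filtered probability space $(\Omega,\mathcal{F},(\mathcal{F}_t)_{t=0,1,\ldots,T},P)$. There is one non-shortable risky stock with price process $S=(S_t)_{t=0,\ldots,T}$, $S_t\in L^0_+(\Omega,\mathcal{F}_t,P)$ (nonnegative real-valued $\mathcal{F}_t$-measurable random variables). The riskless interest rate is a constant $r>0$ and the tax rate is the constant $\alpha$. Strategies. A stock strategy is a family $N=(N_{s,u})_{0\le s\le u\le T}$ with $N_{s,u}\in L^0_+(\Omega,\mathcal{F}_u,P)$ and $N_{s,s}\ge N_{s,s+1}\ge\dots\ge N_{s,T}=0$ for all $s\in\{0,\dots,T\}$ ($N_{s,u}$ is the number of shares bought at time $s$ and still held after trading at time $u$). A pair $(\eta,N)$ with $N$ a stock strategy and $\eta=(\eta_u)_{u=0,\dots,T}$, $\eta_u\in L^0(\Omega,\mathcal{F}_u,P)$, is self-financing for zero initial capital iff, with $\eta_{-1}:=0$, for all $u\in\{0,\dots,T\}$, $$\eta_u-\eta_{u-1}=(1-\alpha)r\,\eta_{u-1}-N_{u,u}S_u+\sum_{s=0}^{u-1}(N_{s,u-1}-N_{s,u})\bigl(S_u-\alpha(S_u-S_s)\bigr).$$ *)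

theory Defs
  imports "HOL-Probability.Probability"
begin

(* Elements of L^0 are represented by measurable functions; relations between them hold
   almost surely. The sub-sigma-algebra G only provides the measurability structure,
   null sets always refer to P. *)

definition L0_plus :: "'a measure \<Rightarrow> 'a measure \<Rightarrow> ('a \<Rightarrow> real) set" where
  "L0_plus P G = {X \<in> borel_measurable G. AE \<omega> in P. 0 \<le> X \<omega>}"

definition stock_strategy ::
  "'a measure \<Rightarrow> (nat \<Rightarrow> 'a measure) \<Rightarrow> nat \<Rightarrow> (nat \<Rightarrow> nat \<Rightarrow> 'a \<Rightarrow> real) \<Rightarrow> bool" where
  "stock_strategy P F T N \<longleftrightarrow>
     (\<forall>s u. s \<le> u \<and> u \<le> T \<longrightarrow> N s u \<in> L0_plus P (F u)) \<and>
     (\<forall>s u. s \<le> u \<and> u < T \<longrightarrow> (AE \<omega> in P. N s (Suc u) \<omega> \<le> N s u \<omega>)) \<and>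
     (\<forall>s\<le>T. AE \<omega> in P. N s T \<omega> = 0)"

(* previous \<eta> u is \<eta> at time u - 1, with the convention that it vanishes at time -1
   (zero initial capital). *)

definition previous :: "(nat \<Rightarrow> 'a \<Rightarrow> real) \<Rightarrow> nat \<Rightarrow> 'a \<Rightarrow> real" where
  "previous \<eta> u \<omega> = (if u = 0 then 0 else \<eta> (u - 1) \<omega>)"

definition self_financing ::
  "'a measure \<Rightarrow> (nat \<Rightarrow> 'a measure) \<Rightarrow> nat \<Rightarrow> (nat \<Rightarrow> 'a \<Rightarrow> real) \<Rightarrow> real \<Rightarrow> real \<Rightarrow>
   (nat \<Rightarrow> 'a \<Rightarrow> real) \<Rightarrow> (nat \<Rightarrow> nat \<Rightarrow> 'a \<Rightarrow> real) \<Rightarrow> bool" where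
  "self_financing P F T S r \<alpha> \<eta> N \<longleftrightarrow>
     stock_strategy P F T N \<and>
     (\<forall>u\<le>T. \<eta> u \<in> borel_measurable (F u)) \<and>
     (\<forall>u\<le>T. AE \<omega> in P.
        \<eta> u \<omega> - previous \<eta> u \<omega> =
          (1 - \<alpha>) * r * previous \<eta> u \<omega> - N u u \<omega> * S u \<omega>
          + (\<Sum>s<u. (N s (u - 1) \<omega> - N s u \<omega>) * (S u \<omega> - \<alpha> * (S u \<omega> - S s \<omega>))))"

(* As Y ranges over all measurable a.s. nonnegative functions, this set contains with a
   function also every measurable function that is a.s. equal to it. *)

definition attainable ::
  "'a measure \<Rightarrow> (nat \<Rightarrow> 'a measure) \<Rightarrow> nat \<Rightarrow> (nat \<Rightarrow> 'a \<Rightarrow> real) \<Rightarrow> real \<Rightarrow> real \<Rightarrow>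
   ('a \<Rightarrow> real) set" where
  "attainable P F T S r \<alpha> =
     {(\<lambda>\<omega>. \<eta> T \<omega> - Y \<omega>) | \<eta> N Y. self_financing P F T S r \<alpha> \<eta> N \<and> Y \<in> L0_plus P P}"

definition tendsto_in_probability ::
  "'a measure \<Rightarrow> (nat \<Rightarrow> 'a \<Rightarrow> real) \<Rightarrow> ('a \<Rightarrow> real) \<Rightarrow> bool" where
  "tendsto_in_probability P X Y \<longleftrightarrow>
     (\<forall>\<epsilon>>0. (\<lambda>n. measure P {\<omega> \<in> space P. \<bar>X n \<omega> - Y \<omega>\<bar> > \<epsilon>}) \<longlonglongrightarrow> 0)"

(* Convergence in probability is metrizable on L^0, so closedness is sequential closedness. *)

definition closed_in_probability :: "'a measure \<Rightarrow> ('a \<Rightarrow> real) set \<Rightarrow> bool" where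
  "closed_in_probability P A \<longleftrightarrow>
     (\<forall>X Y. (\<forall>n. X n \<in> A) \<and> Y \<in> borel_measurable P \<and> tendsto_in_probability P X Y
        \<longrightarrow> Y \<in> A)"

definition conditional_probability :: "'a measure \<Rightarrow> 'a measure \<Rightarrow> 'a set \<Rightarrow> 'a \<Rightarrow> real" where
  "conditional_probability P G A = real_cond_exp P G (indicator A)"

definition equivalent_measure :: "'a measure \<Rightarrow> 'a measure \<Rightarrow> bool" where
  "equivalent_measure P Q \<longleftrightarrow>
     sets Q = sets P \<and> absolutely_continuous P Q \<and> absolutely_continuous Q P"

definition stopping_times ::
  "'a measure \<Rightarrow> (nat \<Rightarrow> 'a measure) \<Rightarrow> nat \<Rightarrow> nat \<Rightarrow> ('a \<Rightarrow> nat) set" where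
  "stopping_times P F T i = {\<tau>. stopping_time F \<tau> \<and> (\<forall>\<omega>\<in>space P. \<tau> \<omega> \<in> {i..T})}"

end

(* Selling all shares at every date turns the self-financing condition into a linear recursion for
   the liquidation wealth, in which each open lot s contributes the excess
   S (u+1) - (1 + (1 - a) r) S u - a r S s of the price over the taxed bank account. On a down move,
   which always has positive conditional probability, every excess is at most - a r S s, so each
   held share then loses a fixed fraction of its purchase price.

   (i) Hence strategies whose terminal wealths are bounded from below have bounded holdings: the lower
   bound is carried back in time along down moves, the upper bounds on the holdings forward. A
   minimizing sequence for a weighted second moment over the tails converges almost surely by the
   parallelogram law, and the limit strategy superhedges the limit wealth.

   (ii) No separation theorem is needed: backward in time one multiplies one-step densities that are 1
   on down moves and so small elsewhere that the excess over every lot has nonpositive conditional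
   expectation. *)

theory Submission
  imports Defs
begin

section \<open>The market and its liquidation value process\<close>

text \<open>Prices carry no moments, and null sets of \<open>P\<close> may be missing from the
  sigma-algebras \<open>F u\<close>; both shape the proof. In (i) the bounds on holdings are found
  for each \<open>\<omega>\<close> separately, so the function dominating them is measurable only
  for \<open>P\<close>. It enters merely as a weight and a constraint in a minimization over adapted
  strategies; the limit is taken along a sequence chosen independently of \<open>\<omega>\<close>,
  so it stays adapted without a random choice of subsequences. Lots bought at price 0 lose nothing
  on a down move and would escape every bound, so they are removed beforehand. In (ii) a single
  density has to serve all lots, whose slacks differ with their purchase prices. The minimum of the
  past prices bounds all these slacks from below, and since 0 is absorbing it is positive wherever
  the price can still rise. Integrability comes from pointwise bounds of damped later prices by
  earlier ones, down to a final damping by the initial price.\<close>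

text \<open>The assumption \<open>down_moves\<close> expresses without conditional expectations that the down move at
  \<open>t + 1\<close> has positive conditional probability given \<open>F t\<close>.\<close>

locale taxed_market = prob_space P
  for P :: "'a measure" +
  fixes F :: "nat \<Rightarrow> 'a measure" and T :: nat
    and S :: "nat \<Rightarrow> 'a \<Rightarrow> real" and r \<alpha> :: real
  assumes F_mono: "s \<le> t \<Longrightarrow> sets (F s) \<subseteq> sets (F t)"
    and subalg: "t \<le> T \<Longrightarrow> subalgebra P (F t)"
    and \<alpha>_pos: "0 < \<alpha>" and \<alpha>_less_1: "\<alpha> < 1" and r_pos: "0 < r"
    and S_adapted: "t \<le> T \<Longrightarrow> S t \<in> borel_measurable (F t)"
    and S_nonneg: "t \<le> T \<Longrightarrow> AE \<omega> in P. 0 \<le> S t \<omega>"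
    and zero_absorbing: "t < T \<Longrightarrow> AE \<omega> in P. S t \<omega> = 0 \<longrightarrow> S (Suc t) \<omega> = 0"
    and down_moves: "t < T \<Longrightarrow> A \<in> sets (F t) \<Longrightarrow>
      (AE \<omega> in P. \<omega> \<in> A \<longrightarrow> \<not> S (Suc t) \<omega> \<le> (1 + (1 - \<alpha>) * r) * S t \<omega>) \<Longrightarrow>
      AE \<omega> in P. \<omega> \<notin> A"
begin

definition growth :: real where
  "growth = 1 + (1 - \<alpha>) * r"

text \<open>The part \<open>\<alpha> * S s\<close> of a share's after-tax value bears no interest,
  while in the bank it would earn \<open>(1 - \<alpha>) * r * \<alpha> * S s\<close> per period.
  After division by the common factor \<open>1 - \<alpha>\<close> this loss is
  \<open>slack * S s\<close>.\<close>

definition slack :: real where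
  "slack = \<alpha> * r"

definition excess :: "nat \<Rightarrow> nat \<Rightarrow> 'a \<Rightarrow> real" where
  "excess s u \<omega> = S (Suc u) \<omega> - growth * S u \<omega> - slack * S s \<omega>"

text \<open>The wealth after selling all shares at time \<open>u\<close>. One share bought at \<open>s\<close> has the
  after-tax value \<open>(1 - \<alpha>) S\<^sub>u + \<alpha> S\<^sub>s\<close>, and \<open>(1 - \<alpha>) excess s u\<close> is the increase of this value
  from \<open>u\<close> to \<open>u + 1\<close> over what it would earn on the bank account.\<close>

primrec wealth :: "(nat \<Rightarrow> nat \<Rightarrow> 'a \<Rightarrow> real) \<Rightarrow> nat \<Rightarrow> 'a \<Rightarrow> real" where
  "wealth N 0 \<omega> = 0"
| "wealth N (Suc u) \<omega> = growth * wealth N u \<omega> + (1 - \<alpha>) * (\<Sum>s\<le>u. N s u \<omega> * excess s u \<omega>)"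

lemma growth_ge_1: "1 \<le> growth"
  using \<alpha>_less_1 r_pos by (simp add: growth_def)

lemma slack_pos: "0 < slack"
  using \<alpha>_pos r_pos by (simp add: slack_def)

lemma space_F: "t \<le> T \<Longrightarrow> space (F t) = space P"
  using subalg by (auto simp: subalgebra_def)

lemma subalgebra_F: "s \<le> t \<Longrightarrow> t \<le> T \<Longrightarrow> subalgebra (F t) (F s)"
  using F_mono[of s t] space_F[of s] space_F[of t] by (auto simp: subalgebra_def)

lemma measurable_F_mono:
  "f \<in> measurable (F s) M \<Longrightarrow> s \<le> t \<Longrightarrow> t \<le> T \<Longrightarrow> f \<in> measurable (F t) M"
  by (rule measurable_from_subalg[OF subalgebra_F])

lemma measurable_F_P: "f \<in> measurable (F s) M \<Longrightarrow> s \<le> T \<Longrightarrow> f \<in> measurable P M"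
  by (rule measurable_from_subalg[OF subalg])

lemma S_measurable_F: "s \<le> t \<Longrightarrow> t \<le> T \<Longrightarrow> S s \<in> borel_measurable (F t)"
  using measurable_F_mono[OF S_adapted] by simp

lemma S_measurable [measurable (raw)]: "s \<le> T \<Longrightarrow> S s \<in> borel_measurable P"
  using measurable_F_P[OF S_adapted] by simp

lemma AE_S_nonneg: "AE \<omega> in P. \<forall>t\<le>T. 0 \<le> S t \<omega>"
  unfolding AE_all_countable using S_nonneg by auto

lemma AE_zero_absorbing: "AE \<omega> in P. \<forall>s u. s \<le> u \<longrightarrow> u \<le> T \<longrightarrow> S s \<omega> = 0 \<longrightarrow> S u \<omega> = 0"
proof -
  have "AE \<omega> in P. \<forall>t. t < T \<longrightarrow> S t \<omega> = 0 \<longrightarrow> S (Suc t) \<omega> = 0"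
    unfolding AE_all_countable using zero_absorbing by auto
  then show ?thesis
  proof (eventually_elim, intro allI impI)
    fix \<omega> s u
    assume step: "\<forall>t. t < T \<longrightarrow> S t \<omega> = 0 \<longrightarrow> S (Suc t) \<omega> = 0"
      and "s \<le> u" "u \<le> T" "S s \<omega> = 0"
    from \<open>s \<le> u\<close> \<open>u \<le> T\<close> show "S u \<omega> = 0"
      by (induction u rule: dec_induct) (use step \<open>S s \<omega> = 0\<close> in auto)
  qed
qed

lemma excess_measurable_F: "s \<le> u \<Longrightarrow> u < T \<Longrightarrow> excess s u \<in> borel_measurable (F (Suc u))"
  unfolding excess_def[abs_def]
  using S_measurable_F[of "Suc u" "Suc u"] S_measurable_F[of u "Suc u"] S_measurable_F[of s "Suc u"]
  by measurable

lemma excess_measurable: "s \<le> u \<Longrightarrow> u < T \<Longrightarrow> excess s u \<in> borel_measurable P"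
  using measurable_F_P[OF excess_measurable_F] by simp

lemma excess_le_of_down_move: "S (Suc u) \<omega> \<le> growth * S u \<omega> \<Longrightarrow> excess s u \<omega> \<le> - slack * S s \<omega>"
  by (simp add: excess_def)

section \<open>Strategies, self-financing and liquidation\<close>

lemma strategyD:
  assumes "stock_strategy P F T N"
  shows strategy_measurable: "s \<le> u \<Longrightarrow> u \<le> T \<Longrightarrow> N s u \<in> borel_measurable (F u)"
    and strategy_nonneg: "AE \<omega> in P. \<forall>s u. s \<le> u \<longrightarrow> u \<le> T \<longrightarrow> 0 \<le> N s u \<omega>"
    and strategy_antimono: "AE \<omega> in P. \<forall>s u. s \<le> u \<longrightarrow> u < T \<longrightarrow> N s (Suc u) \<omega> \<le> N s u \<omega>"
    and strategy_terminal: "AE \<omega> in P. \<forall>s\<le>T. N s T \<omega> = 0"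
  using assms by (auto simp: stock_strategy_def L0_plus_def AE_all_countable)

lemma strategyI:
  assumes "\<And>s u. s \<le> u \<Longrightarrow> u \<le> T \<Longrightarrow> N s u \<in> borel_measurable (F u)"
    and "AE \<omega> in P. \<forall>s u. s \<le> u \<longrightarrow> u \<le> T \<longrightarrow> 0 \<le> N s u \<omega>"
    and "AE \<omega> in P. \<forall>s u. s \<le> u \<longrightarrow> u < T \<longrightarrow> N s (Suc u) \<omega> \<le> N s u \<omega>"
    and "AE \<omega> in P. \<forall>s\<le>T. N s T \<omega> = 0"
  shows "stock_strategy P F T N"
  using assms by (auto simp: stock_strategy_def L0_plus_def AE_all_countable)

lemma wealth_measurable:
  assumes "\<And>s u. s \<le> u \<Longrightarrow> u \<le> T \<Longrightarrow> N s u \<in> borel_measurable (F u)" "u \<le> T"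
  shows "wealth N u \<in> borel_measurable (F u)"
  using \<open>u \<le> T\<close>
proof (induction u)
  case 0
  show ?case by simp
next
  case (Suc u)
  have [measurable]: "wealth N u \<in> borel_measurable (F (Suc u))"
    using measurable_F_mono[OF Suc.IH] Suc.prems by simp
  have [measurable]: "N s u \<in> borel_measurable (F (Suc u))"
    "excess s u \<in> borel_measurable (F (Suc u))" if "s \<le> u" for s
    using Suc.prems that measurable_F_mono[OF assms(1)[of s u]] excess_measurable_F[of s u] by simp_all
  have "wealth N (Suc u) =
      (\<lambda>\<omega>. growth * wealth N u \<omega> + (1 - \<alpha>) * (\<Sum>s\<le>u. N s u \<omega> * excess s u \<omega>))"
    by (rule ext) simp
  then show ?case by simp
qed

text \<open>Each lot is taxed separately and losses are credited at the same rate as gains, so the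
  recursion is linear in the holdings. This gives the convexity needed for midpoints of
  strategies.\<close>

lemma wealth_affine:
  "wealth (\<lambda>s u \<omega>. a * N s u \<omega> + b * M s u \<omega>) u \<omega> = a * wealth N u \<omega> + b * wealth M u \<omega>"
  by (induction u) (simp_all add: algebra_simps sum.distrib sum_distrib_left)

text \<open>By linearity this is an identity for one share carried from \<open>u\<close> to
  \<open>u + 1\<close>. The numbers \<open>n\<close> are the same on both sides because nothing is
  traded between the two dates.\<close>

lemma liquidation_step:
  fixes n :: "nat \<Rightarrow> real" and \<omega> :: 'a and u :: nat
  shows "growth * (\<Sum>s\<le>u. n s * ((1 - \<alpha>) * S u \<omega> + \<alpha> * S s \<omega>))
      + (1 - \<alpha>) * (\<Sum>s\<le>u. n s * excess s u \<omega>)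
    = (\<Sum>s\<le>u. n s * ((1 - \<alpha>) * S (Suc u) \<omega> + \<alpha> * S s \<omega>))"
proof -
  have "growth * (n s * ((1 - \<alpha>) * S u \<omega> + \<alpha> * S s \<omega>)) + (1 - \<alpha>) * (n s * excess s u \<omega>)
      = n s * ((1 - \<alpha>) * S (Suc u) \<omega> + \<alpha> * S s \<omega>)" for s
    unfolding excess_def growth_def slack_def by algebra
  then show ?thesis
    by (simp only: sum_distrib_left flip: sum.distrib)
qed

text \<open>Trading does not change the liquidation wealth: a sale pays exactly the after-tax value
  at which the share was counted, and a purchase exchanges cash for a share of equal liquidation
  value. Only the passage between dates matters, and there \<open>liquidation_step\<close>
  applies.\<close>

lemma self_financing_liquidation:
  assumes "\<forall>u\<le>T. \<eta> u \<omega> - previous \<eta> u \<omega> =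
      (1 - \<alpha>) * r * previous \<eta> u \<omega> - N u u \<omega> * S u \<omega>
      + (\<Sum>s<u. (N s (u - 1) \<omega> - N s u \<omega>) * (S u \<omega> - \<alpha> * (S u \<omega> - S s \<omega>)))"
    and "u \<le> T"
  shows "wealth N u \<omega> = \<eta> u \<omega> + (\<Sum>s\<le>u. N s u \<omega> * ((1 - \<alpha>) * S u \<omega> + \<alpha> * S s \<omega>))"
  using \<open>u \<le> T\<close>
proof (induction u)
  case 0
  then show ?case using assms(1)[rule_format, of 0] by (simp add: previous_def algebra_simps)
next
  case (Suc u)
  have eq: "S (Suc u) \<omega> - \<alpha> * (S (Suc u) \<omega> - x) = (1 - \<alpha>) * S (Suc u) \<omega> + \<alpha> * x" for x
    by (simp add: algebra_simps)
  have "\<eta> (Suc u) \<omega> = growth * \<eta> u \<omega> - N (Suc u) (Suc u) \<omega> * S (Suc u) \<omega>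
      + (\<Sum>s\<le>u. (N s u \<omega> - N s (Suc u) \<omega>) * ((1 - \<alpha>) * S (Suc u) \<omega> + \<alpha> * S s \<omega>))"
    using assms(1)[rule_format, of "Suc u"] Suc.prems
    unfolding eq previous_def growth_def lessThan_Suc_atMost distrib_right[of 1] by simp
  also have "(\<Sum>s\<le>u. (N s u \<omega> - N s (Suc u) \<omega>) * ((1 - \<alpha>) * S (Suc u) \<omega> + \<alpha> * S s \<omega>))
      = (\<Sum>s\<le>u. N s u \<omega> * ((1 - \<alpha>) * S (Suc u) \<omega> + \<alpha> * S s \<omega>))
        - (\<Sum>s\<le>u. N s (Suc u) \<omega> * ((1 - \<alpha>) * S (Suc u) \<omega> + \<alpha> * S s \<omega>))"
    by (simp only: left_diff_distrib sum_subtractf)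
  also note liquidation_step[of "\<lambda>s. N s u \<omega>" u \<omega>, symmetric]
  finally have "growth * (\<eta> u \<omega> + (\<Sum>s\<le>u. N s u \<omega> * ((1 - \<alpha>) * S u \<omega> + \<alpha> * S s \<omega>)))
      + (1 - \<alpha>) * (\<Sum>s\<le>u. N s u \<omega> * excess s u \<omega>)
    = \<eta> (Suc u) \<omega> + (\<Sum>s\<le>u. N s (Suc u) \<omega> * ((1 - \<alpha>) * S (Suc u) \<omega> + \<alpha> * S s \<omega>))
      + N (Suc u) (Suc u) \<omega> * S (Suc u) \<omega>"
    unfolding distrib_left[of growth] by linarith
  \<comment> \<open>A fresh lot has no book gain, so its after-tax value is its price; this turns
    its cost into the summand \<open>s = Suc u\<close>.\<close>
  moreover have "N (Suc u) (Suc u) \<omega> * S (Suc u) \<omega>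
      = N (Suc u) (Suc u) \<omega> * ((1 - \<alpha>) * S (Suc u) \<omega> + \<alpha> * S (Suc u) \<omega>)"
    by (simp add: left_diff_distrib)
  ultimately show ?case
    using Suc.IH Suc.prems by simp
qed

text \<open>Conversely, every stock strategy can be financed, since the bank account absorbs all
  payments. The preceding identity leaves only this choice of the account.\<close>

lemma self_financing_of_liquidation:
  assumes "\<And>u. u \<le> T \<Longrightarrow>
      \<eta> u \<omega> = wealth N u \<omega> - (\<Sum>s\<le>u. N s u \<omega> * ((1 - \<alpha>) * S u \<omega> + \<alpha> * S s \<omega>))"
    and "u \<le> T"
  shows "\<eta> u \<omega> - previous \<eta> u \<omega> =
      (1 - \<alpha>) * r * previous \<eta> u \<omega> - N u u \<omega> * S u \<omega>
      + (\<Sum>s<u. (N s (u - 1) \<omega> - N s u \<omega>) * (S u \<omega> - \<alpha> * (S u \<omega> - S s \<omega>)))"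
proof (cases u)
  case 0
  then show ?thesis using assms(1)[of 0] by (simp add: previous_def algebra_simps)
next
  case (Suc v)
  have "(\<Sum>s<u. (N s (u - 1) \<omega> - N s u \<omega>) * (S u \<omega> - \<alpha> * (S u \<omega> - S s \<omega>)))
    = (\<Sum>s\<le>v. N s v \<omega> * ((1 - \<alpha>) * S u \<omega> + \<alpha> * S s \<omega>))
      - (\<Sum>s\<le>v. N s u \<omega> * ((1 - \<alpha>) * S u \<omega> + \<alpha> * S s \<omega>))"
    unfolding sum_subtractf[symmetric] Suc lessThan_Suc_atMost
    by (intro sum.cong refl) (simp, algebra)
  moreover have "\<eta> u \<omega> = growth * wealth N v \<omega> + (1 - \<alpha>) * (\<Sum>s\<le>v. N s v \<omega> * excess s v \<omega>)
      - (\<Sum>s\<le>v. N s u \<omega> * ((1 - \<alpha>) * S u \<omega> + \<alpha> * S s \<omega>)) - N u u \<omega> * S u \<omega>"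
    using assms(1)[of u] assms(2) by (simp add: Suc left_diff_distrib)
  moreover have "growth * \<eta> v \<omega> = growth * wealth N v \<omega>
      - growth * (\<Sum>s\<le>v. N s v \<omega> * ((1 - \<alpha>) * S v \<omega> + \<alpha> * S s \<omega>))"
    using assms(1)[of v] assms(2) by (simp add: Suc right_diff_distrib)
  moreover have "growth * \<eta> v \<omega> = previous \<eta> u \<omega> + (1 - \<alpha>) * r * previous \<eta> u \<omega>"
    by (simp add: Suc previous_def growth_def distrib_right)
  ultimately show ?thesis
    using liquidation_step[of "\<lambda>s. N s v \<omega>" v \<omega>] unfolding Suc by linarith
qed

text \<open>At \<open>T\<close> every lot is sold, so \<open>\<eta> T\<close> is the liquidation
  wealth. This eliminates the bank account, and subtracting \<open>L0_plus\<close> becomes an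
  inequality, leaving a condition on the stock strategy alone.\<close>

lemma attainable_iff:
  "X \<in> attainable P F T S r \<alpha> \<longleftrightarrow> X \<in> borel_measurable P \<and>
     (\<exists>N. stock_strategy P F T N \<and> (AE \<omega> in P. X \<omega> \<le> wealth N T \<omega>))"
proof (intro iffI conjI; (elim conjE exE)?)
  assume "X \<in> attainable P F T S r \<alpha>"
  obtain \<eta> N Y where X: "X = (\<lambda>\<omega>. \<eta> T \<omega> - Y \<omega>)"
    and sf: "self_financing P F T S r \<alpha> \<eta> N" and Y: "Y \<in> L0_plus P P"
    using \<open>X \<in> attainable P F T S r \<alpha>\<close> unfolding attainable_def mem_Collect_eq
    by (elim exE conjE)
  have N: "stock_strategy P F T N" and "\<eta> T \<in> borel_measurable (F T)"
    using sf by (simp_all add: self_financing_def)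
  then have [measurable]: "\<eta> T \<in> borel_measurable P" "Y \<in> borel_measurable P"
    using Y measurable_F_P by (auto simp: L0_plus_def)
  show "X \<in> borel_measurable P"
    unfolding X by measurable
  have "AE \<omega> in P. \<forall>u\<le>T. \<eta> u \<omega> - previous \<eta> u \<omega> =
      (1 - \<alpha>) * r * previous \<eta> u \<omega> - N u u \<omega> * S u \<omega>
      + (\<Sum>s<u. (N s (u - 1) \<omega> - N s u \<omega>) * (S u \<omega> - \<alpha> * (S u \<omega> - S s \<omega>)))"
    using sf by (simp add: self_financing_def AE_all_countable)
  moreover have "AE \<omega> in P. 0 \<le> Y \<omega>" using Y by (simp add: L0_plus_def)
  ultimately have "AE \<omega> in P. X \<omega> \<le> wealth N T \<omega>"
    using strategy_terminal[OF N]
  proof eventually_elim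
    case (elim \<omega>)
    then show ?case using self_financing_liquidation[where \<eta>=\<eta> and N=N, OF elim(1) order_refl] by (simp add: X)
  qed
  with N show "\<exists>N. stock_strategy P F T N \<and> (AE \<omega> in P. X \<omega> \<le> wealth N T \<omega>)" by blast
next
  fix N
  assume X [measurable]: "X \<in> borel_measurable P" and N: "stock_strategy P F T N"
    and le: "AE \<omega> in P. X \<omega> \<le> wealth N T \<omega>"
  define \<eta> where "\<eta> u \<omega> = wealth N u \<omega> - (\<Sum>s\<le>u. N s u \<omega> * ((1 - \<alpha>) * S u \<omega> + \<alpha> * S s \<omega>))"
    for u \<omega>
  have \<eta>: "\<eta> u \<in> borel_measurable (F u)" if "u \<le> T" for u
  proof -
    have [measurable]: "wealth N u \<in> borel_measurable (F u)" "S u \<in> borel_measurable (F u)"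
      using that wealth_measurable[OF strategy_measurable[OF N]] S_adapted by auto
    have [measurable]: "N s u \<in> borel_measurable (F u)" "S s \<in> borel_measurable (F u)"
      if "s \<le> u" for s
      using that \<open>u \<le> T\<close> strategy_measurable[OF N] S_measurable_F by auto
    show ?thesis unfolding \<eta>_def[abs_def] by measurable
  qed
  have "self_financing P F T S r \<alpha> \<eta> N"
    unfolding self_financing_def
    using N \<eta> self_financing_of_liquidation[of \<eta> _ N] by (auto simp: \<eta>_def)
  moreover have "AE \<omega> in P. \<eta> T \<omega> = wealth N T \<omega>"
    using strategy_terminal[OF N] by eventually_elim (simp add: \<eta>_def)
  then have "(\<lambda>\<omega>. \<eta> T \<omega> - X \<omega>) \<in> L0_plus P P"
    using le measurable_F_P[OF \<eta>[OF order_refl] order_refl] by (auto simp: L0_plus_def)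
  ultimately show "X \<in> attainable P F T S r \<alpha>"
    unfolding attainable_def
    by (intro CollectI exI[of _ \<eta>] exI[of _ N] exI[of _ "\<lambda>\<omega>. \<eta> T \<omega> - X \<omega>"]) auto
qed

end

section \<open>Convergence\<close>

text \<open>Weighted by \<open>2 ^ m\<close>, the second moments are still bounded by a summable
  multiple of \<open>(1/4) ^ m\<close>. Hence the weighted squares are summable almost surely, and
  they control the terms themselves up to a geometric series.\<close>

lemma (in prob_space) AE_summable_of_second_moments:
  fixes g :: "nat \<Rightarrow> 'a \<Rightarrow> real"
  assumes [measurable]: "\<And>m. g m \<in> borel_measurable M"
    and int: "\<And>m. integrable M (\<lambda>\<omega>. (g m \<omega>)\<^sup>2)"
    and le: "\<And>m. (\<integral>\<omega>. (g m \<omega>)\<^sup>2 \<partial>M) \<le> C * (1/8) ^ m"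
  shows "AE \<omega> in M. summable (\<lambda>m. g m \<omega>)"
proof -
  have le': "(\<integral>\<^sup>+\<omega>. ennreal (2 ^ m * (g m \<omega>)\<^sup>2) \<partial>M) \<le> ennreal (C * (1/4) ^ m)" for m
  proof -
    have "(\<integral>\<^sup>+\<omega>. ennreal (2 ^ m * (g m \<omega>)\<^sup>2) \<partial>M) = ennreal (\<integral>\<omega>. 2 ^ m * (g m \<omega>)\<^sup>2 \<partial>M)"
      using int by (intro nn_integral_eq_integral) auto
    also have "(\<integral>\<omega>. 2 ^ m * (g m \<omega>)\<^sup>2 \<partial>M) \<le> 2 ^ m * (C * (1/8) ^ m)"
      using le by simp
    also have "\<dots> = C * (1/4) ^ m"
      by (simp add: power_mult_distrib[symmetric])
    finally show ?thesis by (simp add: ennreal_leI)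
  qed
  have "0 \<le> C"
  proof -
    have "0 \<le> (\<integral>\<omega>. (g 0 \<omega>)\<^sup>2 \<partial>M)" by simp
    also note le[of 0]
    finally show ?thesis by simp
  qed
  then have "(\<Sum>m. ennreal (C * (1/4) ^ m)) = ennreal (\<Sum>m. C * (1/4) ^ m)"
    by (intro suminf_ennreal2 summable_mult summable_geometric) auto
  have "(\<integral>\<^sup>+\<omega>. (\<Sum>m. ennreal (2 ^ m * (g m \<omega>)\<^sup>2)) \<partial>M)
      = (\<Sum>m. \<integral>\<^sup>+\<omega>. ennreal (2 ^ m * (g m \<omega>)\<^sup>2) \<partial>M)"
    by (intro nn_integral_suminf) simp
  also have "\<dots> \<le> (\<Sum>m. ennreal (C * (1/4) ^ m))"
    by (intro suminf_le le') auto
  also have "\<dots> = ennreal (\<Sum>m. C * (1/4) ^ m)"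
    by fact
  also have "\<dots> < \<infinity>" by simp
  finally have "AE \<omega> in M. (\<Sum>m. ennreal (2 ^ m * (g m \<omega>)\<^sup>2)) \<noteq> \<infinity>"
    by (intro nn_integral_noteq_infinite) auto
  then show ?thesis
  proof eventually_elim
    case (elim \<omega>)
    then have "summable (\<lambda>m. 2 ^ m * (g m \<omega>)\<^sup>2)"
      by (intro summable_suminf_not_top) auto
    then have "summable (\<lambda>m. (1/2) ^ m + 2 ^ m * (g m \<omega>)\<^sup>2)"
      by (intro summable_add summable_geometric) auto
    \<comment> \<open>A term is either at most \<open>(1/2) ^ m\<close>, or multiplying it by
      \<open>2 ^ m * \<bar>g m \<omega>\<bar> \<ge> 1\<close> bounds it by its weighted
      square.\<close>
    moreover have "norm (g m \<omega>) \<le> (1/2) ^ m + 2 ^ m * (g m \<omega>)\<^sup>2" for m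
    proof (cases "\<bar>g m \<omega>\<bar> \<le> (1/2) ^ m")
      case True
      have "0 \<le> 2 ^ m * (g m \<omega>)\<^sup>2" by simp
      then show ?thesis using True unfolding real_norm_def by linarith
    next
      case False
      then have "1 \<le> 2 ^ m * \<bar>g m \<omega>\<bar>"
        by (simp add: power_divide field_simps)
      then have "1 * \<bar>g m \<omega>\<bar> \<le> 2 ^ m * \<bar>g m \<omega>\<bar> * \<bar>g m \<omega>\<bar>"
        by (intro mult_right_mono) auto
      also have "\<dots> = 2 ^ m * (g m \<omega>)\<^sup>2"
        by (simp add: power2_eq_square mult.assoc flip: abs_mult)
      finally have "\<bar>g m \<omega>\<bar> \<le> 2 ^ m * (g m \<omega>)\<^sup>2" by simp
      moreover have "0 \<le> (1/2 :: real) ^ m" by simp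
      ultimately show ?thesis unfolding real_norm_def by linarith
    qed
    ultimately show ?case
      by (blast intro: summable_comparison_test')
  qed
qed

lemma convergent_of_summable_differences:
  fixes x :: "nat \<Rightarrow> real"
  assumes "summable (\<lambda>m. x m - x (Suc m))"
  shows "convergent x"
proof -
  have "convergent (\<lambda>n. \<Sum>m<n. x m - x (Suc m))"
    using assms by (simp add: summable_iff_convergent)
  then have "convergent (\<lambda>n. x 0 - x n)"
    by (simp add: sum_lessThan_telescope')
  from convergent_diff[OF convergent_const this, of "x 0"] show ?thesis by simp
qed

text \<open>Almost minimizers of \<open>q\<close> over the sets \<open>C n\<close> form a Cauchy sequence: their midpoints cannot
  have much smaller \<open>q\<close>-value, so the parallelogram law bounds their distance \<open>\<delta>\<close>.\<close>

lemma asymptotically_minimal_sequence: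
  fixes C :: "nat \<Rightarrow> 'v set" and q :: "'v \<Rightarrow> real" and \<delta> :: "'v \<Rightarrow> 'v \<Rightarrow> real"
  assumes "decseq C"
    and q_nonneg: "\<And>n x. x \<in> C n \<Longrightarrow> 0 \<le> q x"
    and q_bounded: "\<And>n. \<exists>x\<in>C n. q x \<le> K"
    and mid: "\<And>n x y. x \<in> C n \<Longrightarrow> y \<in> C n \<Longrightarrow> \<exists>z\<in>C n. \<delta> x y \<le> 2 * q x + 2 * q y - 4 * q z"
  obtains v where "\<And>m. v m \<in> C m" and "\<And>m. \<delta> (v m) (v (Suc m)) \<le> 8 * (1/8) ^ m"
proof -
  define d where "d n = Inf (q ` C n)" for n
  have bdd: "bdd_below (q ` C n)" for n
    using q_nonneg by (auto intro: bdd_belowI[of _ 0])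
  have ne: "q ` C n \<noteq> {}" for n
    using q_bounded[of n] by auto
  have d_le: "d n \<le> q x" if "x \<in> C n" for n x
    unfolding d_def using that bdd by (intro cInf_lower) auto
  have d_mono: "d i \<le> d j" if "i \<le> j" for i j
    unfolding d_def using decseqD[OF \<open>decseq C\<close> that] ne bdd
    by (intro cInf_superset_mono) auto
  have d_bound: "d n \<le> K" for n
    using q_bounded[of n] d_le by force
  have bdd_d: "bdd_above (range d)"
    using d_bound by (intro bdd_aboveI[of _ K]) auto
  \<comment> \<open>Smaller sets have larger infima, so \<open>d\<close> increases to the finite
    limit \<open>e\<close>. The index \<open>i m\<close> is chosen such that \<open>d (i m)\<close>
    is within \<open>(1/8) ^ m\<close> of it.\<close>
  define e where "e = (SUP n. d n)"
  have d_le_e: "d n \<le> e" for n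
    unfolding e_def by (intro cSUP_upper bdd_d) auto
  have "\<exists>n\<ge>m. e - (1/8) ^ m < d n" for m :: nat
  proof -
    have "e - (1/8) ^ m < (SUP n. d n)" by (simp add: e_def)
    then obtain n where "e - (1/8) ^ m < d n"
      using less_cSUP_iff[OF _ bdd_d] by auto
    then have "e - (1/8) ^ m < d (max m n)"
      using d_mono[of n "max m n"] by simp
    then show ?thesis by (intro exI[of _ "max m n"]) simp
  qed
  then obtain i where i: "\<And>m. m \<le> i m" "\<And>m. e - (1/8) ^ m < d (i m)" by metis
  have "\<exists>x\<in>C (i m). q x < e + (1/8) ^ m" for m
  proof -
    have "Inf (q ` C (i m)) < e + (1/8) ^ m"
      using d_le_e[of "i m"] by (simp add: d_def[symmetric] add_le_less_mono[of _ e 0, simplified])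
    then show ?thesis using cInf_less_iff[OF ne bdd] by auto
  qed
  then obtain v where v: "\<And>m. v m \<in> C (i m)" "\<And>m. q (v m) < e + (1/8) ^ m" by metis
  show thesis
  proof
    show "v m \<in> C m" for m
      using v(1)[of m] decseqD[OF \<open>decseq C\<close> i(1)[of m]] by auto
    fix m
    \<comment> \<open>The indices \<open>i m\<close> need not increase in \<open>m\<close>, so the
      midpoint is taken in the larger of the two sets. Its value is still above
      \<open>e - (1/8) ^ m\<close>, both endpoints lie below \<open>e + (1/8) ^ m\<close>, and the
      factors 2, 2 and 4 cancel \<open>e\<close> and leave the constant 8.\<close>
    define n where "n = min (i m) (i (Suc m))"
    have "v m \<in> C n" "v (Suc m) \<in> C n"
      using v(1)[of m] v(1)[of "Suc m"] decseqD[OF \<open>decseq C\<close>, of n "i m"]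
        decseqD[OF \<open>decseq C\<close>, of n "i (Suc m)"] by (auto simp: n_def)
    from mid[OF this] obtain z where z: "z \<in> C n"
      and \<delta>: "\<delta> (v m) (v (Suc m)) \<le> 2 * q (v m) + 2 * q (v (Suc m)) - 4 * q z" by auto
    have pow: "(1/8 :: real) ^ Suc m \<le> (1/8) ^ m" by simp
    have "d n = d (i m) \<or> d n = d (i (Suc m))"
      by (simp add: n_def min_def)
    then have "e - (1/8) ^ m < d n"
      using i(2)[of m] i(2)[of "Suc m"] pow by linarith
    then show "\<delta> (v m) (v (Suc m)) \<le> 8 * (1/8) ^ m"
      using \<delta> d_le[OF z] v(2)[of m] v(2)[of "Suc m"] pow by linarith
  qed
qed

text \<open>The supremum exists and is measurable in \<open>ennreal\<close>. Since
  \<open>enn2real\<close> sends infinity to 0, the resulting function is finite everywhere, and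
  domination is lost only on the null set of unbounded paths.\<close>

lemma exists_measurable_dominating:
  fixes f :: "nat \<Rightarrow> 'a \<Rightarrow> real"
  assumes [measurable]: "\<And>k. f k \<in> borel_measurable M"
    and bdd: "AE \<omega> in M. \<exists>K. \<forall>k. \<bar>f k \<omega>\<bar> \<le> K"
  obtains W where "W \<in> borel_measurable M" "\<And>\<omega>. 0 \<le> W \<omega>" "AE \<omega> in M. \<forall>k. \<bar>f k \<omega>\<bar> \<le> W \<omega>"
proof
  define H where "H \<omega> = (SUP k. ennreal \<bar>f k \<omega>\<bar>)" for \<omega>
  have [measurable]: "H \<in> borel_measurable M"
    unfolding H_def[abs_def] by measurable
  show "(\<lambda>\<omega>. enn2real (H \<omega>)) \<in> borel_measurable M" by measurable
  show "0 \<le> enn2real (H \<omega>)" for \<omega> by simp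
  show "AE \<omega> in M. \<forall>k. \<bar>f k \<omega>\<bar> \<le> enn2real (H \<omega>)"
    using bdd
  proof (eventually_elim, intro allI)
    fix \<omega> k
    assume "\<exists>K. \<forall>k. \<bar>f k \<omega>\<bar> \<le> K"
    then obtain K where K: "\<And>k. \<bar>f k \<omega>\<bar> \<le> K" by auto
    have "H \<omega> \<le> ennreal K"
      unfolding H_def by (intro SUP_least ennreal_leI K)
    then have "H \<omega> < \<top>" by (auto intro: le_less_trans)
    moreover have "ennreal \<bar>f k \<omega>\<bar> \<le> H \<omega>"
      unfolding H_def by (intro SUP_upper) simp
    ultimately show "\<bar>f k \<omega>\<bar> \<le> enn2real (H \<omega>)"
      by (cases "H \<omega>" rule: ennreal_cases) auto
  qed
qed

text \<open>Truncating the distance at 1 turns convergence in probability into convergence in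
  \<open>L^1\<close>, which has almost surely convergent subsequences. Once the truncated distance
  falls below 1 it is the true distance.\<close>

lemma (in prob_space) tendsto_in_probability_AE_subseq:
  fixes X :: "nat \<Rightarrow> 'a \<Rightarrow> real"
  assumes [measurable]: "\<And>n. X n \<in> borel_measurable M" "Y \<in> borel_measurable M"
    and lim: "tendsto_in_probability M X Y"
  shows "\<exists>j :: nat \<Rightarrow> nat. strict_mono j \<and> (AE \<omega> in M. (\<lambda>n. X (j n) \<omega>) \<longlonglongrightarrow> Y \<omega>)"
proof -
  define D where "D n \<omega> = min 1 \<bar>X n \<omega> - Y \<omega>\<bar>" for n \<omega>
  have [measurable]: "D n \<in> borel_measurable M" for n
    unfolding D_def[abs_def] by measurable
  have int: "integrable M (D n)" for n
    by (rule integrable_const_bound[of _ 1]) (auto simp: D_def)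
  \<comment> \<open>The integrand is at most \<open>\<epsilon>\<close> off the deviation event and
    at most 1 on it.\<close>
  have bound: "(\<integral>\<omega>. norm (D n \<omega>) \<partial>M) \<le> \<epsilon> + measure M {\<omega> \<in> space M. \<epsilon> < \<bar>X n \<omega> - Y \<omega>\<bar>}"
    if "0 < \<epsilon>" for n \<epsilon>
  proof -
    let ?A = "{\<omega> \<in> space M. \<epsilon> < \<bar>X n \<omega> - Y \<omega>\<bar>}"
    have "(\<integral>\<omega>. norm (D n \<omega>) \<partial>M) \<le> (\<integral>\<omega>. \<epsilon> + indicator ?A \<omega> \<partial>M)"
    proof (rule integral_mono)
      show "integrable M (\<lambda>\<omega>. \<epsilon> + indicator ?A \<omega>)"
        by (intro Bochner_Integration.integrable_add integrable_const) (auto simp: less_top[symmetric])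
      fix \<omega> assume "\<omega> \<in> space M"
      then show "norm (D n \<omega>) \<le> \<epsilon> + indicator ?A \<omega>"
        using that by (auto simp: D_def indicator_def)
    qed (use int in auto)
    also have "\<dots> = \<epsilon> + measure M ?A"
      by (subst Bochner_Integration.integral_add) (auto simp: prob_space less_top[symmetric])
    finally show ?thesis .
  qed
  have "(\<lambda>n. \<integral>\<omega>. norm (D n \<omega>) \<partial>M) \<longlonglongrightarrow> 0"
  proof (rule LIMSEQ_I)
    fix e :: real assume "0 < e"
    then have "(\<lambda>n. measure M {\<omega> \<in> space M. e / 2 < \<bar>X n \<omega> - Y \<omega>\<bar>}) \<longlonglongrightarrow> 0"
      using lim[unfolded tendsto_in_probability_def, rule_format, of "e / 2"] by simp
    from LIMSEQ_D[OF this, of "e / 2"] \<open>0 < e\<close> obtain n0 where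
      n0: "\<And>n. n \<ge> n0 \<Longrightarrow> measure M {\<omega> \<in> space M. e / 2 < \<bar>X n \<omega> - Y \<omega>\<bar>} < e / 2" by auto
    have "norm ((\<integral>\<omega>. norm (D n \<omega>) \<partial>M) - 0) < e" if "n \<ge> n0" for n
    proof -
      have "0 \<le> (\<integral>\<omega>. norm (D n \<omega>) \<partial>M)" by simp
      then show ?thesis using n0[OF that] bound[of "e / 2" n] \<open>0 < e\<close> unfolding real_norm_def by linarith
    qed
    then show "\<exists>n0. \<forall>n\<ge>n0. norm ((\<integral>\<omega>. norm (D n \<omega>) \<partial>M) - 0) < e" by blast
  qed
  from tendsto_L1_AE_subseq[OF int this] obtain j :: "nat \<Rightarrow> nat"
    where "strict_mono j" and j: "AE \<omega> in M. (\<lambda>n. D (j n) \<omega>) \<longlonglongrightarrow> 0" by auto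
  have "AE \<omega> in M. (\<lambda>n. X (j n) \<omega>) \<longlonglongrightarrow> Y \<omega>"
    using j
  proof eventually_elim
    case (elim \<omega>)
    have "eventually (\<lambda>n. D (j n) \<omega> < 1) sequentially"
      using order_tendstoD(2)[OF elim, of 1] by simp
    then have "eventually (\<lambda>n. D (j n) \<omega> = \<bar>X (j n) \<omega> - Y \<omega>\<bar>) sequentially"
      by eventually_elim (auto simp: D_def min_def split: if_splits)
    with elim have "(\<lambda>n. \<bar>X (j n) \<omega> - Y \<omega>\<bar>) \<longlonglongrightarrow> 0"
      by (rule Lim_transform_eventually)
    then show ?case
      by (metis LIM_zero_cancel tendsto_rabs_zero_cancel)
  qed
  with \<open>strict_mono j\<close> show ?thesis by blast
qed

context taxed_market
begin

section \<open>Closedness of the attainable wealths\<close>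

lemma wealth_down_move_le:
  assumes "S (Suc u) \<omega> \<le> growth * S u \<omega>" "\<And>s. s \<le> u \<Longrightarrow> 0 \<le> N s u \<omega>"
  shows "wealth N (Suc u) \<omega>
    \<le> growth * wealth N u \<omega> - (1 - \<alpha>) * slack * (\<Sum>s\<le>u. N s u \<omega> * S s \<omega>)"
proof -
  have "(\<Sum>s\<le>u. N s u \<omega> * excess s u \<omega>) \<le> (\<Sum>s\<le>u. N s u \<omega> * (- slack * S s \<omega>))"
    using assms by (intro sum_mono mult_left_mono excess_le_of_down_move) auto
  also have "\<dots> = - slack * (\<Sum>s\<le>u. N s u \<omega> * S s \<omega>)"
    by (simp add: sum_distrib_left mult.left_commute sum_negf)
  finally have "(1 - \<alpha>) * (\<Sum>s\<le>u. N s u \<omega> * excess s u \<omega>)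
      \<le> (1 - \<alpha>) * (- slack * (\<Sum>s\<le>u. N s u \<omega> * S s \<omega>))"
    using \<alpha>_less_1 by (intro mult_left_mono) auto
  then show ?thesis by simp
qed

text \<open>The quantity \<open>?x k\<close> is known at \<open>u\<close> and dominates the wealth
  at \<open>u + 1\<close> on a down move. Where \<open>?x\<close> is unbounded below in
  \<open>k\<close>, a down move would contradict the assumed bound. This set is an event of
  \<open>F u\<close> that almost surely excludes the down move, hence null by
  \<open>down_moves\<close>.\<close>

lemma lower_bound_before_down_move:
  assumes N: "\<And>k. stock_strategy P F T (N k)" and "u < T"
    and bdd: "AE \<omega> in P. \<exists>c. \<forall>k :: nat. c \<le> wealth (N k) (Suc u) \<omega>"
  shows "AE \<omega> in P. \<exists>c. \<forall>k.
    c \<le> growth * wealth (N k) u \<omega> - (1 - \<alpha>) * slack * (\<Sum>s\<le>u. N k s u \<omega> * S s \<omega>)"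
    (is "AE \<omega> in P. \<exists>c. \<forall>k. c \<le> ?x k \<omega>")
proof -
  define A where "A = {\<omega> \<in> space (F u). \<forall>i::nat. \<exists>k. ?x k \<omega> < - real i}"
  have [measurable]: "wealth (N k) u \<in> borel_measurable (F u)" for k
    using wealth_measurable[OF strategy_measurable[OF N]] \<open>u < T\<close> by simp
  have [measurable]: "N k s u \<in> borel_measurable (F u)" "S s \<in> borel_measurable (F u)" if "s \<le> u" for k s
    using strategy_measurable[OF N] S_measurable_F that \<open>u < T\<close> by auto
  have "A \<in> sets (F u)"
    unfolding A_def by measurable
  moreover have "AE \<omega> in P. \<omega> \<in> A \<longrightarrow> \<not> S (Suc u) \<omega> \<le> (1 + (1 - \<alpha>) * r) * S u \<omega>"
  proof -
    have "AE \<omega> in P. \<forall>k s u. s \<le> u \<longrightarrow> u \<le> T \<longrightarrow> 0 \<le> N k s u \<omega>"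
      unfolding AE_all_countable using strategy_nonneg[OF N] by (auto simp: AE_all_countable)
    with bdd show ?thesis
    proof (eventually_elim, intro impI notI)
      fix \<omega>
      assume "\<exists>c. \<forall>k. c \<le> wealth (N k) (Suc u) \<omega>"
        and nonneg: "\<forall>k s u. s \<le> u \<longrightarrow> u \<le> T \<longrightarrow> 0 \<le> N k s u \<omega>"
        and "\<omega> \<in> A" and down: "S (Suc u) \<omega> \<le> (1 + (1 - \<alpha>) * r) * S u \<omega>"
      then obtain c where c: "\<And>k. c \<le> wealth (N k) (Suc u) \<omega>" by auto
      obtain i :: nat where "- c \<le> real i" using real_arch_simple by blast
      moreover obtain k where "?x k \<omega> < - real i" using \<open>\<omega> \<in> A\<close> by (auto simp: A_def)
      moreover have "wealth (N k) (Suc u) \<omega> \<le> ?x k \<omega>"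
        using down nonneg \<open>u < T\<close> by (intro wealth_down_move_le) (auto simp: growth_def)
      ultimately show False using c[of k] by linarith
    qed
  qed
  ultimately have "AE \<omega> in P. \<omega> \<notin> A"
    using down_moves \<open>u < T\<close> by blast
  with AE_space show ?thesis
  proof eventually_elim
    case (elim \<omega>)
    then obtain i :: nat where "\<And>k. - real i \<le> ?x k \<omega>"
      using space_F[of u] \<open>u < T\<close> by (auto simp: A_def not_less)
    then show ?case by blast
  qed
qed

lemma wealth_lower_bound:
  assumes N: "\<And>k. stock_strategy P F T (N k)" and "u \<le> T"
    and bdd: "AE \<omega> in P. \<exists>c. \<forall>k :: nat. c \<le> wealth (N k) T \<omega>"
  shows "AE \<omega> in P. \<exists>c. \<forall>k. c \<le> wealth (N k) u \<omega>"
  using \<open>u \<le> T\<close>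
proof (induction u rule: inc_induct)
  case base
  then show ?case by (rule bdd)
next
  case (step u)
  have "AE \<omega> in P. \<forall>k s u. s \<le> u \<longrightarrow> u \<le> T \<longrightarrow> 0 \<le> N k s u \<omega>"
    unfolding AE_all_countable using strategy_nonneg[OF N] by (auto simp: AE_all_countable)
  with lower_bound_before_down_move[OF N \<open>u < T\<close> step.IH] AE_S_nonneg show ?case
  proof eventually_elim
    case (elim \<omega>)
    then obtain c where
      c: "\<And>k. c \<le> growth * wealth (N k) u \<omega> - (1 - \<alpha>) * slack * (\<Sum>s\<le>u. N k s u \<omega> * S s \<omega>)"
      by auto
    have "c / growth \<le> wealth (N k) u \<omega>" for k
    proof -
      have "0 \<le> (1 - \<alpha>) * slack * (\<Sum>s\<le>u. N k s u \<omega> * S s \<omega>)"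
        using elim \<alpha>_less_1 slack_pos \<open>u < T\<close> by (intro mult_nonneg_nonneg sum_nonneg) auto
      then show ?thesis
        using c[of k] growth_ge_1 by (simp add: pos_divide_le_eq mult.commute)
    qed
    then show ?case by blast
  qed
qed

text \<open>Along a fixed path, an upper bound on wealth at \<open>u\<close> and the lower bound
  before a down move leave only a bounded amount to be invested. Dividing by the purchase prices
  bounds the holdings, and these bound the wealth at \<open>u + 1\<close>. The induction starts from
  wealth 0.\<close>

lemma holdings_bounded:
  assumes N: "\<And>k. stock_strategy P F T (N k)"
    and supp: "\<And>k s u \<omega>. S s \<omega> \<le> 0 \<Longrightarrow> N k s u \<omega> = 0"
    and bdd: "AE \<omega> in P. \<exists>c. \<forall>k :: nat. c \<le> wealth (N k) T \<omega>"
  shows "AE \<omega> in P. \<forall>s u. s \<le> u \<longrightarrow> u \<le> T \<longrightarrow> (\<exists>K. \<forall>k. N k s u \<omega> \<le> K)"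
proof -
  have "AE \<omega> in P. \<forall>u. u < T \<longrightarrow> (\<exists>c. \<forall>k.
      c \<le> growth * wealth (N k) u \<omega> - (1 - \<alpha>) * slack * (\<Sum>s\<le>u. N k s u \<omega> * S s \<omega>))"
    unfolding AE_all_countable
    using lower_bound_before_down_move[OF N _ wealth_lower_bound[OF N _ bdd]] by auto
  moreover have "AE \<omega> in P. \<forall>k s u. s \<le> u \<longrightarrow> u \<le> T \<longrightarrow> 0 \<le> N k s u \<omega>"
    unfolding AE_all_countable using strategy_nonneg[OF N] by (auto simp: AE_all_countable)
  moreover have "AE \<omega> in P. \<forall>k. \<forall>s\<le>T. N k s T \<omega> = 0"
    unfolding AE_all_countable using strategy_terminal[OF N] by (auto simp: AE_all_countable)
  ultimately show ?thesis
    using AE_S_nonneg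
  proof eventually_elim
    case (elim \<omega>)
    have holdings: "\<exists>K. \<forall>k. \<forall>s\<le>u. N k s u \<omega> \<le> K"
      if "u < T" "\<And>k. wealth (N k) u \<omega> \<le> c" for u c
    proof -
      from elim(1) \<open>u < T\<close> obtain b where
        b: "\<And>k. b \<le> growth * wealth (N k) u \<omega> - (1 - \<alpha>) * slack * (\<Sum>s\<le>u. N k s u \<omega> * S s \<omega>)"
        by blast
      define D where "D = (growth * c - b) / ((1 - \<alpha>) * slack)"
      have total: "(\<Sum>s\<le>u. N k s u \<omega> * S s \<omega>) \<le> D" for k
      proof -
        have "growth * wealth (N k) u \<omega> \<le> growth * c"
          using that(2) growth_ge_1 by (intro mult_left_mono) auto
        with b[of k] have "(1 - \<alpha>) * slack * (\<Sum>s\<le>u. N k s u \<omega> * S s \<omega>) \<le> growth * c - b"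
          by linarith
        then show ?thesis
          unfolding D_def using \<alpha>_less_1 slack_pos by (subst pos_le_divide_eq) (auto simp: mult.commute)
      qed
      \<comment> \<open>For \<open>S s \<omega> = 0\<close> the quotient is 0 by convention, and the
        bound is saved by \<open>supp\<close>. The absolute value keeps the summands nonnegative, so
        their sum bounds all lots at once.\<close>
      have each: "N k s u \<omega> \<le> \<bar>D\<bar> / S s \<omega>" if "s \<le> u" for k s
      proof (cases "S s \<omega> > 0")
        case True
        have "N k s u \<omega> * S s \<omega> \<le> (\<Sum>s\<le>u. N k s u \<omega> * S s \<omega>)"
          using that elim \<open>u < T\<close> by (intro member_le_sum) auto
        with total[of k] True show ?thesis by (simp add: pos_le_divide_eq)
      next
        case False
        with elim that \<open>u < T\<close> have "S s \<omega> = 0" by (simp add: not_less order_antisym)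
        then show ?thesis using supp[of s \<omega>] by simp
      qed
      have "N k s u \<omega> \<le> (\<Sum>s\<le>u. \<bar>D\<bar> / S s \<omega>)" if "s \<le> u" for k s
      proof -
        have "\<bar>D\<bar> / S s \<omega> \<le> (\<Sum>s\<le>u. \<bar>D\<bar> / S s \<omega>)"
          using that elim \<open>u < T\<close> by (intro member_le_sum) auto
        with each[OF that, of k] show ?thesis by linarith
      qed
      then show ?thesis by blast
    qed
    have wealth_bdd: "\<exists>c. \<forall>k. wealth (N k) u \<omega> \<le> c" if "u \<le> T" for u
      using that
    proof (induction u)
      case 0
      show ?case by (auto intro!: exI[of _ 0])
    next
      case (Suc u)
      then obtain c where c: "\<And>k. wealth (N k) u \<omega> \<le> c" by auto
      with holdings[of u c] Suc obtain K where K: "\<And>k s. s \<le> u \<Longrightarrow> N k s u \<omega> \<le> K" by auto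
      have "wealth (N k) (Suc u) \<omega> \<le> growth * c + (1 - \<alpha>) * (\<Sum>s\<le>u. K * \<bar>excess s u \<omega>\<bar>)" for k
      proof -
        have "N k s u \<omega> * excess s u \<omega> \<le> K * \<bar>excess s u \<omega>\<bar>" if "s \<le> u" for s
        proof -
          have "N k s u \<omega> * excess s u \<omega> \<le> N k s u \<omega> * \<bar>excess s u \<omega>\<bar>"
            using elim that Suc.prems by (intro mult_left_mono) auto
          also have "\<dots> \<le> K * \<bar>excess s u \<omega>\<bar>"
            using K[OF that] by (intro mult_right_mono) auto
          finally show ?thesis .
        qed
        then show ?thesis
          using c[of k] growth_ge_1 \<alpha>_less_1
          by (auto intro!: add_mono mult_left_mono sum_mono)
      qed
      then show ?case by blast
    qed
    show ?case
    proof (intro allI impI)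
      fix s u :: nat assume "s \<le> u" "u \<le> T"
      show "\<exists>K. \<forall>k. N k s u \<omega> \<le> K"
      proof (cases "u = T")
        case True
        then show ?thesis using elim \<open>s \<le> u\<close> by (intro exI[of _ 0]) auto
      next
        case False
        with \<open>u \<le> T\<close> have "u < T" by simp
        moreover obtain c where "\<And>k. wealth (N k) u \<omega> \<le> c" using wealth_bdd[OF \<open>u \<le> T\<close>] by auto
        ultimately show ?thesis using holdings[of u c] \<open>s \<le> u\<close> by blast
      qed
    qed
  qed
qed

text \<open>A share bought at price 0 stays worthless, so all its excesses vanish and arbitrarily
  many such shares leave wealth unchanged. Whether a lot is discarded is known at its purchase date
  and does not depend on \<open>u\<close>, which preserves adaptedness and monotonicity.\<close>

lemma exists_strategy_without_worthless_shares:
  assumes N: "stock_strategy P F T N"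
  obtains N' where "stock_strategy P F T N'" "AE \<omega> in P. wealth N' T \<omega> = wealth N T \<omega>"
    "\<And>s u \<omega>. S s \<omega> \<le> 0 \<Longrightarrow> N' s u \<omega> = 0"
proof
  define N' where "N' s u \<omega> = (if 0 < S s \<omega> then N s u \<omega> else 0)" for s u \<omega>
  show "stock_strategy P F T N'"
  proof (rule strategyI)
    fix s u assume "s \<le> u" "u \<le> T"
    then have [measurable]: "N s u \<in> borel_measurable (F u)" "S s \<in> borel_measurable (F u)"
      using strategy_measurable[OF N] S_measurable_F by auto
    show "N' s u \<in> borel_measurable (F u)"
      unfolding N'_def[abs_def] by measurable
  next
    show "AE \<omega> in P. \<forall>s u. s \<le> u \<longrightarrow> u \<le> T \<longrightarrow> 0 \<le> N' s u \<omega>"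
      using strategy_nonneg[OF N] by eventually_elim (auto simp: N'_def)
    show "AE \<omega> in P. \<forall>s u. s \<le> u \<longrightarrow> u < T \<longrightarrow> N' s (Suc u) \<omega> \<le> N' s u \<omega>"
      using strategy_antimono[OF N] by eventually_elim (auto simp: N'_def)
    show "AE \<omega> in P. \<forall>s\<le>T. N' s T \<omega> = 0"
      using strategy_terminal[OF N] by eventually_elim (auto simp: N'_def)
  qed
  show "AE \<omega> in P. wealth N' T \<omega> = wealth N T \<omega>"
    using AE_S_nonneg AE_zero_absorbing
  proof eventually_elim
    case (elim \<omega>)
    have "wealth N' u \<omega> = wealth N u \<omega>" if "u \<le> T" for u
      using that
    proof (induction u)
      case (Suc u)
      have "N' s u \<omega> * excess s u \<omega> = N s u \<omega> * excess s u \<omega>" if "s \<le> u" for s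
      proof (cases "0 < S s \<omega>")
        case False
        then have s: "S s \<omega> = 0" using elim that Suc.prems by (simp add: not_less order_antisym)
        have "S u \<omega> = 0" "S (Suc u) \<omega> = 0"
          using elim(2)[rule_format, of s u] elim(2)[rule_format, of s "Suc u"] s that Suc.prems
          by auto
        then show ?thesis using s by (simp add: excess_def)
      qed (simp add: N'_def)
      then have "(\<Sum>s\<le>u. N' s u \<omega> * excess s u \<omega>) = (\<Sum>s\<le>u. N s u \<omega> * excess s u \<omega>)"
        by (intro sum.cong) auto
      then show ?case using Suc by simp
    qed simp
    then show ?case by simp
  qed
  show "N' s u \<omega> = 0" if "S s \<omega> \<le> 0" for s u \<omega>
    using that by (simp add: N'_def)
qed

section \<open>Midpoints and limits of strategies\<close>

lemma tendsto_wealth: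
  assumes "\<And>s u. s \<le> u \<Longrightarrow> u \<le> T \<Longrightarrow> (\<lambda>m :: nat. V m s u \<omega>) \<longlonglongrightarrow> N s u \<omega>" and "u \<le> T"
  shows "(\<lambda>m. wealth (V m) u \<omega>) \<longlonglongrightarrow> wealth N u \<omega>"
  using \<open>u \<le> T\<close>
  by (induction u) (auto intro!: tendsto_add tendsto_mult_left tendsto_mult_right tendsto_sum assms)


lemma mid_strategy:
  assumes N: "stock_strategy P F T N" and M: "stock_strategy P F T M"
  shows "stock_strategy P F T (\<lambda>s u \<omega>. 1/2 * N s u \<omega> + 1/2 * M s u \<omega>)"
proof (rule strategyI)
  fix s u assume "s \<le> u" "u \<le> T"
  then have [measurable]: "N s u \<in> borel_measurable (F u)" "M s u \<in> borel_measurable (F u)"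
    using strategy_measurable[OF N] strategy_measurable[OF M] by auto
  show "(\<lambda>\<omega>. 1/2 * N s u \<omega> + 1/2 * M s u \<omega>) \<in> borel_measurable (F u)"
    by measurable
next
  show "AE \<omega> in P. \<forall>s u. s \<le> u \<longrightarrow> u \<le> T \<longrightarrow> 0 \<le> 1/2 * N s u \<omega> + 1/2 * M s u \<omega>"
    using strategy_nonneg[OF N] strategy_nonneg[OF M] by eventually_elim auto
  show "AE \<omega> in P. \<forall>s u. s \<le> u \<longrightarrow> u < T \<longrightarrow>
      1/2 * N s (Suc u) \<omega> + 1/2 * M s (Suc u) \<omega> \<le> 1/2 * N s u \<omega> + 1/2 * M s u \<omega>"
    using strategy_antimono[OF N] strategy_antimono[OF M] by eventually_elim (auto intro!: add_mono)
  show "AE \<omega> in P. \<forall>s\<le>T. 1/2 * N s T \<omega> + 1/2 * M s T \<omega> = 0"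
    using strategy_terminal[OF N] strategy_terminal[OF M] by eventually_elim auto
qed

text \<open>The function \<open>lim\<close> is defined at every \<open>\<omega>\<close> and is
  measurable for \<open>F u\<close> even where the sequence diverges. Thus the limit is adapted in
  the strict sense although convergence holds only almost surely.\<close>

lemma limit_strategy:
  assumes V: "\<And>m :: nat. stock_strategy P F T (V m)"
    and conv: "AE \<omega> in P. \<forall>s u. s \<le> u \<longrightarrow> u \<le> T \<longrightarrow> convergent (\<lambda>m. V m s u \<omega>)"
  defines "N \<equiv> \<lambda>s u \<omega>. lim (\<lambda>m. V m s u \<omega>)"
  shows "stock_strategy P F T N"
    and "AE \<omega> in P. (\<lambda>m. wealth (V m) T \<omega>) \<longlonglongrightarrow> wealth N T \<omega>"
proof -
  have lim: "AE \<omega> in P. \<forall>s u. s \<le> u \<longrightarrow> u \<le> T \<longrightarrow> (\<lambda>m. V m s u \<omega>) \<longlonglongrightarrow> N s u \<omega>"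
    using conv by eventually_elim (auto simp: N_def convergent_LIMSEQ_iff)
  then show "AE \<omega> in P. (\<lambda>m. wealth (V m) T \<omega>) \<longlonglongrightarrow> wealth N T \<omega>"
    by eventually_elim (auto intro: tendsto_wealth)
  have nonneg: "AE \<omega> in P. \<forall>m. \<forall>s u. s \<le> u \<longrightarrow> u \<le> T \<longrightarrow> 0 \<le> V m s u \<omega>"
    unfolding AE_all_countable[of "\<lambda>m \<omega>. \<forall>s u. s \<le> u \<longrightarrow> u \<le> T \<longrightarrow> 0 \<le> V m s u \<omega>"]
    using strategy_nonneg[OF V] by blast
  have antimono: "AE \<omega> in P. \<forall>m. \<forall>s u. s \<le> u \<longrightarrow> u < T \<longrightarrow> V m s (Suc u) \<omega> \<le> V m s u \<omega>"
    unfolding AE_all_countable[of "\<lambda>m \<omega>. \<forall>s u. s \<le> u \<longrightarrow> u < T \<longrightarrow> V m s (Suc u) \<omega> \<le> V m s u \<omega>"]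
    using strategy_antimono[OF V] by blast
  have terminal: "AE \<omega> in P. \<forall>m. \<forall>s\<le>T. V m s T \<omega> = 0"
    unfolding AE_all_countable[of "\<lambda>m \<omega>. \<forall>s\<le>T. V m s T \<omega> = 0"]
    using strategy_terminal[OF V] by blast
  show "stock_strategy P F T N"
  proof (rule strategyI)
    fix s u assume "s \<le> u" "u \<le> T"
    then show "N s u \<in> borel_measurable (F u)"
      unfolding N_def using strategy_measurable[OF V] by (intro borel_measurable_lim_metric) auto
  next
    show "AE \<omega> in P. \<forall>s u. s \<le> u \<longrightarrow> u \<le> T \<longrightarrow> 0 \<le> N s u \<omega>"
      using lim nonneg by eventually_elim (blast intro: LIMSEQ_le_const)
    show "AE \<omega> in P. \<forall>s u. s \<le> u \<longrightarrow> u < T \<longrightarrow> N s (Suc u) \<omega> \<le> N s u \<omega>"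
      using lim antimono
    proof (eventually_elim, intro allI impI)
      fix \<omega> s u
      assume "\<forall>s u. s \<le> u \<longrightarrow> u \<le> T \<longrightarrow> (\<lambda>m. V m s u \<omega>) \<longlonglongrightarrow> N s u \<omega>"
        "\<forall>m s u. s \<le> u \<longrightarrow> u < T \<longrightarrow> V m s (Suc u) \<omega> \<le> V m s u \<omega>" "s \<le> u" "u < T"
      then show "N s (Suc u) \<omega> \<le> N s u \<omega>"
        by (intro LIMSEQ_le[of "\<lambda>m. V m s (Suc u) \<omega>" _ "\<lambda>m. V m s u \<omega>"]) auto
    qed
    show "AE \<omega> in P. \<forall>s\<le>T. N s T \<omega> = 0"
      using terminal by eventually_elim (simp add: N_def)
  qed
qed

text \<open>The competitors are the dominated strategies whose wealth is at least the infimum of the tail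
  of \<open>X\<close>: these sets are convex, and minimizing a weighted second moment over them replaces a
  compactness argument.\<close>

lemma attainable_closed_AE:
  assumes X: "\<And>k. X k \<in> attainable P F T S r \<alpha>"
    and Y: "Y \<in> borel_measurable P" and lim: "AE \<omega> in P. (\<lambda>k :: nat. X k \<omega>) \<longlonglongrightarrow> Y \<omega>"
  shows "Y \<in> attainable P F T S r \<alpha>"
proof -
  have "\<exists>N. stock_strategy P F T N \<and> (AE \<omega> in P. X k \<omega> \<le> wealth N T \<omega>) \<and>
      (\<forall>s u \<omega>. S s \<omega> \<le> 0 \<longrightarrow> N s u \<omega> = 0)" for k
  proof -
    obtain N0 where N0: "stock_strategy P F T N0" "AE \<omega> in P. X k \<omega> \<le> wealth N0 T \<omega>"
      using X[of k] by (auto simp: attainable_iff)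
    obtain N where N: "stock_strategy P F T N" "AE \<omega> in P. wealth N T \<omega> = wealth N0 T \<omega>"
      "\<And>s u \<omega>. S s \<omega> \<le> 0 \<Longrightarrow> N s u \<omega> = 0"
      using exists_strategy_without_worthless_shares[OF N0(1)] by blast
    have "AE \<omega> in P. X k \<omega> \<le> wealth N T \<omega>"
      using N0(2) N(2) by eventually_elim simp
    with N show ?thesis by blast
  qed
  then obtain N where N: "\<And>k. stock_strategy P F T (N k)"
    and "\<And>k. AE \<omega> in P. X k \<omega> \<le> wealth (N k) T \<omega>"
    and supp: "\<And>k s u \<omega>. S s \<omega> \<le> 0 \<Longrightarrow> N k s u \<omega> = 0"
    by metis
  then have dom: "AE \<omega> in P. \<forall>k. X k \<omega> \<le> wealth (N k) T \<omega>"
    by (simp add: AE_all_countable)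
  have "AE \<omega> in P. \<exists>c. \<forall>k. c \<le> wealth (N k) T \<omega>"
    using dom lim
  proof eventually_elim
    case (elim \<omega>)
    have "Bseq (\<lambda>k. X k \<omega>)"
      using elim(2) by (intro convergent_imp_Bseq convergentI)
    then obtain K where K: "\<And>k. \<bar>X k \<omega>\<bar> \<le> K"
      by (auto simp: Bseq_def)
    have "- K \<le> wealth (N k) T \<omega>" for k
      using elim(1)[rule_format, of k] K[of k] by linarith
    then show ?case by blast
  qed
  with N supp have N_bdd: "AE \<omega> in P. \<forall>s u. s \<le> u \<longrightarrow> u \<le> T \<longrightarrow> (\<exists>K. \<forall>k. N k s u \<omega> \<le> K)"
    by (rule holdings_bounded)

  define I where "I = {(s, u). s \<le> u \<and> u \<le> T}"
  have "finite I"
    by (rule finite_subset[of _ "{..T} \<times> {..T}"]) (auto simp: I_def)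
  have N_nonneg: "AE \<omega> in P. \<forall>k. \<forall>s u. s \<le> u \<longrightarrow> u \<le> T \<longrightarrow> 0 \<le> N k s u \<omega>"
    unfolding AE_all_countable[of "\<lambda>k \<omega>. \<forall>s u. s \<le> u \<longrightarrow> u \<le> T \<longrightarrow> 0 \<le> N k s u \<omega>"]
    using strategy_nonneg[OF N] by blast
  have meas: "M s u \<in> borel_measurable P" if "(s, u) \<in> I" "stock_strategy P F T M" for M s u
    using that(1) by (intro measurable_F_P[OF strategy_measurable[OF that(2)], of s u]) (simp_all add: I_def)
  \<comment> \<open>Holdings are nonnegative, so the sum dominates each entry and one function
    \<open>W\<close> serves for all pairs in \<open>I\<close>.\<close>
  define f where "f k \<omega> = (\<Sum>(s, u)\<in>I. N k s u \<omega>)" for k \<omega>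
  have f_meas: "f k \<in> borel_measurable P" for k
    unfolding f_def[abs_def] using meas[OF _ N] by (intro borel_measurable_sum) auto
  have "AE \<omega> in P. \<exists>K. \<forall>k. \<bar>f k \<omega>\<bar> \<le> K"
    using N_bdd N_nonneg
  proof eventually_elim
    case (elim \<omega>)
    then have "\<forall>p\<in>I. \<exists>K. \<forall>k. N k (fst p) (snd p) \<omega> \<le> K" by (auto simp: I_def)
    then obtain K where K: "\<And>p k. p \<in> I \<Longrightarrow> N k (fst p) (snd p) \<omega> \<le> K p" by metis
    have "\<bar>f k \<omega>\<bar> \<le> sum K I" for k
    proof -
      have "0 \<le> f k \<omega>" using elim by (auto simp: f_def I_def intro!: sum_nonneg)
      moreover have "f k \<omega> \<le> sum K I" unfolding f_def using K by (intro sum_mono) auto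
      ultimately show ?thesis by simp
    qed
    then show ?case by blast
  qed
  with f_meas obtain W where [measurable]: "W \<in> borel_measurable P" and W_nonneg: "\<And>\<omega>. 0 \<le> W \<omega>"
    and W: "AE \<omega> in P. \<forall>k. \<bar>f k \<omega>\<bar> \<le> W \<omega>"
    using exists_measurable_dominating by blast

  \<comment> \<open>Quantifying over lower bounds \<open>l\<close> expresses domination of the tail
    infimum and is vacuous where the tail is unbounded below. A later tail has more lower bounds, so
    the sets decrease.\<close>
  define C where "C n = {M. stock_strategy P F T M \<and> (AE \<omega> in P. \<forall>(s, u)\<in>I. \<bar>M s u \<omega>\<bar> \<le> W \<omega>) \<and>
      (AE \<omega> in P. \<forall>l. (\<forall>k\<ge>n. l \<le> X k \<omega>) \<longrightarrow> l \<le> wealth M T \<omega>)}" for n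
  \<comment> \<open>\<open>W\<close> may fail to be integrable; dividing by \<open>1 + W\<close>
    makes every integrand at most 1 on the competitors.\<close>
  define q where "q M = (\<Sum>(s, u)\<in>I. \<integral>\<omega>. (M s u \<omega> / (1 + W \<omega>))\<^sup>2 \<partial>P)" for M
  define \<delta> where "\<delta> M M' = (\<Sum>(s, u)\<in>I. \<integral>\<omega>. ((M s u \<omega> - M' s u \<omega>) / (1 + W \<omega>))\<^sup>2 \<partial>P)" for M M'

  have le_1: "\<bar>x / (1 + W \<omega>)\<bar> \<le> 1" if "\<bar>x\<bar> \<le> W \<omega>" for x \<omega>
    using that W_nonneg[of \<omega>] by (simp add: abs_if divide_simps split: if_splits)
  have C_AE_le: "AE \<omega> in P. \<bar>M s u \<omega> / (1 + W \<omega>)\<bar> \<le> 1" if "M \<in> C n" "(s, u) \<in> I" for M n s u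
  proof -
    have "AE \<omega> in P. \<forall>(s, u)\<in>I. \<bar>M s u \<omega>\<bar> \<le> W \<omega>" using that by (simp add: C_def)
    then show ?thesis by eventually_elim (use that le_1 in auto)
  qed
  have C_meas: "M s u \<in> borel_measurable P" if "M \<in> C n" "(s, u) \<in> I" for M n s u
    using that meas by (auto simp: C_def)
  have C_int: "integrable P (\<lambda>\<omega>. (M s u \<omega> / (1 + W \<omega>))\<^sup>2)" if "M \<in> C n" "(s, u) \<in> I" for M n s u
  proof (rule integrable_const_bound[of _ 1])
    have [measurable]: "M s u \<in> borel_measurable P" using C_meas that by blast
    show "(\<lambda>\<omega>. (M s u \<omega> / (1 + W \<omega>))\<^sup>2) \<in> borel_measurable P" by measurable
    show "AE \<omega> in P. norm ((M s u \<omega> / (1 + W \<omega>))\<^sup>2) \<le> 1"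
      using C_AE_le[OF that] by eventually_elim (simp add: abs_square_le_1)
  qed
  have C_prod_int: "integrable P (\<lambda>\<omega>. (M s u \<omega> / (1 + W \<omega>)) * (M' s u \<omega> / (1 + W \<omega>)))"
    if "M \<in> C n" "M' \<in> C n'" "(s, u) \<in> I" for M M' n n' s u
  proof (rule integrable_const_bound[of _ 1])
    have [measurable]: "M s u \<in> borel_measurable P" "M' s u \<in> borel_measurable P"
      using C_meas that by blast+
    show "(\<lambda>\<omega>. (M s u \<omega> / (1 + W \<omega>)) * (M' s u \<omega> / (1 + W \<omega>))) \<in> borel_measurable P" by measurable
    show "AE \<omega> in P. norm ((M s u \<omega> / (1 + W \<omega>)) * (M' s u \<omega> / (1 + W \<omega>))) \<le> 1"
      using C_AE_le[OF that(1,3)] C_AE_le[OF that(2,3)]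
      by eventually_elim (simp only: real_norm_def abs_mult, intro mult_le_one, auto)
  qed
  have diff_int: "integrable P (\<lambda>\<omega>. ((M s u \<omega> - M' s u \<omega>) / (1 + W \<omega>))\<^sup>2)"
    if "M \<in> C n" "M' \<in> C n'" "(s, u) \<in> I" for M M' n n' s u
  proof -
    have "((M s u \<omega> - M' s u \<omega>) / (1 + W \<omega>))\<^sup>2 = (M s u \<omega> / (1 + W \<omega>))\<^sup>2 + (M' s u \<omega> / (1 + W \<omega>))\<^sup>2
        - 2 * ((M s u \<omega> / (1 + W \<omega>)) * (M' s u \<omega> / (1 + W \<omega>)))" for \<omega>
      unfolding diff_divide_distrib by algebra
    then show ?thesis
      by (simp only:) (intro Bochner_Integration.integrable_diff Bochner_Integration.integrable_add
        integrable_mult_right C_int[OF that(1,3)] C_int[OF that(2,3)] C_prod_int[OF that])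
  qed

  have "decseq C"
  proof (rule decseq_SucI, rule subsetI)
    fix n M assume M: "M \<in> C (Suc n)"
    then have "AE \<omega> in P. \<forall>l. (\<forall>k\<ge>Suc n. l \<le> X k \<omega>) \<longrightarrow> l \<le> wealth M T \<omega>"
      by (simp add: C_def)
    then have "AE \<omega> in P. \<forall>l. (\<forall>k\<ge>n. l \<le> X k \<omega>) \<longrightarrow> l \<le> wealth M T \<omega>"
      by eventually_elim (meson Suc_leD)
    with M show "M \<in> C n"
      by (simp add: C_def)
  qed
  have N_in_C: "N n \<in> C n" for n
  proof -
    have "AE \<omega> in P. \<forall>(s, u)\<in>I. \<bar>N n s u \<omega>\<bar> \<le> W \<omega>"
      using W N_nonneg
    proof (eventually_elim, safe)
      fix \<omega> s u
      assume W: "\<forall>k. \<bar>f k \<omega>\<bar> \<le> W \<omega>" and nonneg: "\<forall>k s u. s \<le> u \<longrightarrow> u \<le> T \<longrightarrow> 0 \<le> N k s u \<omega>"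
        and su: "(s, u) \<in> I"
      have "(case (s, u) of (s, u) \<Rightarrow> N n s u \<omega>) \<le> f n \<omega>"
        unfolding f_def using nonneg su \<open>finite I\<close> by (intro member_le_sum) (auto simp: I_def)
      then show "\<bar>N n s u \<omega>\<bar> \<le> W \<omega>"
        using W[rule_format, of n] nonneg su by (auto simp: I_def)
    qed
    moreover have "AE \<omega> in P. \<forall>l. (\<forall>k\<ge>n. l \<le> X k \<omega>) \<longrightarrow> l \<le> wealth (N n) T \<omega>"
      using dom by eventually_elim (blast intro: order_trans)
    ultimately show ?thesis using N by (simp add: C_def)
  qed
  have q_nonneg: "0 \<le> q M" for M
    unfolding q_def by (intro sum_nonneg) auto
  have q_le: "q M \<le> card I" if "M \<in> C n" for M n
  proof -
    have "(\<integral>\<omega>. (M s u \<omega> / (1 + W \<omega>))\<^sup>2 \<partial>P) \<le> 1" if "(s, u) \<in> I" for s u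
    proof -
      have "(\<integral>\<omega>. (M s u \<omega> / (1 + W \<omega>))\<^sup>2 \<partial>P) \<le> (\<integral>\<omega>. 1 \<partial>P)"
      proof (rule integral_mono_AE)
        show "AE \<omega> in P. (M s u \<omega> / (1 + W \<omega>))\<^sup>2 \<le> 1"
          using C_AE_le[OF \<open>M \<in> C n\<close> that] by eventually_elim (simp add: abs_square_le_1)
      qed (use C_int[OF \<open>M \<in> C n\<close> that] in auto)
      then show ?thesis by (simp add: prob_space)
    qed
    then have "q M \<le> (\<Sum>p\<in>I. 1)"
      unfolding q_def by (intro sum_mono) auto
    then show ?thesis by simp
  qed
  have mid: "\<exists>z\<in>C n. \<delta> M M' \<le> 2 * q M + 2 * q M' - 4 * q z" if M: "M \<in> C n" "M' \<in> C n" for n M M'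
  proof
    let ?Z = "\<lambda>s u \<omega>. 1/2 * M s u \<omega> + 1/2 * M' s u \<omega>"
    have "AE \<omega> in P. \<forall>(s, u)\<in>I. \<bar>M s u \<omega>\<bar> \<le> W \<omega>" "AE \<omega> in P. \<forall>(s, u)\<in>I. \<bar>M' s u \<omega>\<bar> \<le> W \<omega>"
      using M by (auto simp: C_def)
    then have "AE \<omega> in P. \<forall>(s, u)\<in>I. \<bar>?Z s u \<omega>\<bar> \<le> W \<omega>"
      by eventually_elim fastforce
    moreover have "AE \<omega> in P. \<forall>l. (\<forall>k\<ge>n. l \<le> X k \<omega>) \<longrightarrow> l \<le> wealth M T \<omega>"
      "AE \<omega> in P. \<forall>l. (\<forall>k\<ge>n. l \<le> X k \<omega>) \<longrightarrow> l \<le> wealth M' T \<omega>"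
      using M by (auto simp: C_def)
    then have "AE \<omega> in P. \<forall>l. (\<forall>k\<ge>n. l \<le> X k \<omega>) \<longrightarrow> l \<le> wealth ?Z T \<omega>"
      unfolding wealth_affine by eventually_elim fastforce
    ultimately show Z: "?Z \<in> C n"
      using M mid_strategy by (auto simp: C_def)
    have "(\<integral>\<omega>. ((M s u \<omega> - M' s u \<omega>) / (1 + W \<omega>))\<^sup>2 \<partial>P)
        = 2 * (\<integral>\<omega>. (M s u \<omega> / (1 + W \<omega>))\<^sup>2 \<partial>P) + 2 * (\<integral>\<omega>. (M' s u \<omega> / (1 + W \<omega>))\<^sup>2 \<partial>P)
          - 4 * (\<integral>\<omega>. (?Z s u \<omega> / (1 + W \<omega>))\<^sup>2 \<partial>P)" if su: "(s, u) \<in> I" for s u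
    proof -
      have "((M s u \<omega> - M' s u \<omega>) / (1 + W \<omega>))\<^sup>2 = 2 * (M s u \<omega> / (1 + W \<omega>))\<^sup>2
          + 2 * (M' s u \<omega> / (1 + W \<omega>))\<^sup>2 - 4 * (?Z s u \<omega> / (1 + W \<omega>))\<^sup>2" for \<omega>
      proof -
        have "(x - y)\<^sup>2 = 2 * x\<^sup>2 + 2 * y\<^sup>2 - 4 * (1/2 * x + 1/2 * y)\<^sup>2" for x y :: real
          by (simp add: power2_eq_square field_simps)
        then show ?thesis
          unfolding diff_divide_distrib add_divide_distrib times_divide_eq_right[symmetric] .
      qed
      then show ?thesis
        using C_int[OF M(1) su] C_int[OF M(2) su] C_int[OF Z su] by simp
    qed
    then have "\<delta> M M' = (\<Sum>(s, u)\<in>I. 2 * (\<integral>\<omega>. (M s u \<omega> / (1 + W \<omega>))\<^sup>2 \<partial>P)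
          + 2 * (\<integral>\<omega>. (M' s u \<omega> / (1 + W \<omega>))\<^sup>2 \<partial>P) - 4 * (\<integral>\<omega>. (?Z s u \<omega> / (1 + W \<omega>))\<^sup>2 \<partial>P))"
      unfolding \<delta>_def by (intro sum.cong) auto
    also have "\<dots> = 2 * q M + 2 * q M' - 4 * q ?Z"
      unfolding q_def by (simp only: split_def sum.distrib sum_subtractf sum_distrib_left)
    finally show "\<delta> M M' \<le> 2 * q M + 2 * q M' - 4 * q ?Z" by simp
  qed
  obtain V where V: "\<And>m. V m \<in> C m" and \<delta>: "\<And>m. \<delta> (V m) (V (Suc m)) \<le> 8 * (1/8) ^ m"
    using asymptotically_minimal_sequence[of C q "real (card I)" \<delta>, OF \<open>decseq C\<close> q_nonneg _ mid]
      N_in_C q_le by blast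

  have V_strategy: "stock_strategy P F T (V m)" for m
    using V[of m] by (simp add: C_def)
  have "AE \<omega> in P. convergent (\<lambda>m. V m s u \<omega>)" if su: "(s, u) \<in> I" for s u
  proof -
    have [measurable]: "V m s u \<in> borel_measurable P" for m
      using C_meas V su by blast
    have "AE \<omega> in P. summable (\<lambda>m. (V m s u \<omega> - V (Suc m) s u \<omega>) / (1 + W \<omega>))"
    proof (rule AE_summable_of_second_moments)
      show "integrable P (\<lambda>\<omega>. ((V m s u \<omega> - V (Suc m) s u \<omega>) / (1 + W \<omega>))\<^sup>2)" for m
        using diff_int[OF V V su] .
      have "(\<integral>\<omega>. ((V m s u \<omega> - V (Suc m) s u \<omega>) / (1 + W \<omega>))\<^sup>2 \<partial>P) \<le> \<delta> (V m) (V (Suc m))" for m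
      proof -
        have "(case (s, u) of (s, u) \<Rightarrow> \<integral>\<omega>. ((V m s u \<omega> - V (Suc m) s u \<omega>) / (1 + W \<omega>))\<^sup>2 \<partial>P)
            \<le> \<delta> (V m) (V (Suc m))"
          unfolding \<delta>_def using su \<open>finite I\<close> by (intro member_le_sum) auto
        then show ?thesis by simp
      qed
      then show "(\<integral>\<omega>. ((V m s u \<omega> - V (Suc m) s u \<omega>) / (1 + W \<omega>))\<^sup>2 \<partial>P) \<le> 8 * (1/8) ^ m" for m
        using \<delta> order_trans by blast
    qed measurable
    then show ?thesis
    proof eventually_elim
      case (elim \<omega>)
      \<comment> \<open>For fixed \<open>\<omega>\<close> the weight is a constant and can be
        removed from the series.\<close>
      have "1 + W \<omega> \<noteq> 0" using W_nonneg[of \<omega>] by simp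
      have "summable (\<lambda>m. (1 + W \<omega>) * ((V m s u \<omega> - V (Suc m) s u \<omega>) / (1 + W \<omega>)))"
        using elim by (rule summable_mult)
      then have "summable (\<lambda>m. V m s u \<omega> - V (Suc m) s u \<omega>)"
        using \<open>1 + W \<omega> \<noteq> 0\<close> by simp
      then show ?case by (rule convergent_of_summable_differences)
    qed
  qed
  then have conv: "AE \<omega> in P. \<forall>s u. s \<le> u \<longrightarrow> u \<le> T \<longrightarrow> convergent (\<lambda>m. V m s u \<omega>)"
    by (auto simp: AE_all_countable I_def)
  define N' where "N' s u \<omega> = lim (\<lambda>m. V m s u \<omega>)" for s u \<omega>
  have N': "stock_strategy P F T N'" "AE \<omega> in P. (\<lambda>m. wealth (V m) T \<omega>) \<longlonglongrightarrow> wealth N' T \<omega>"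
    using limit_strategy[OF V_strategy conv] by (simp_all add: N'_def[abs_def])
  have "AE \<omega> in P. \<forall>m. \<forall>l. (\<forall>k\<ge>m. l \<le> X k \<omega>) \<longrightarrow> l \<le> wealth (V m) T \<omega>"
    unfolding AE_all_countable[of "\<lambda>m \<omega>. \<forall>l. (\<forall>k\<ge>m. l \<le> X k \<omega>) \<longrightarrow> l \<le> wealth (V m) T \<omega>"]
    using V by (simp add: C_def)
  with lim N'(2) have "AE \<omega> in P. Y \<omega> \<le> wealth N' T \<omega>"
  proof eventually_elim
    case (elim \<omega>)
    show ?case
    proof (rule field_le_epsilon)
      fix e :: real assume "0 < e"
      \<comment> \<open>\<open>Y \<omega> - e\<close> is a lower bound of every tail from
        \<open>m0\<close> on, so membership in \<open>C m\<close> passes it to the wealth of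
        \<open>V m\<close>.\<close>
      then obtain m0 where m0: "\<And>k. k \<ge> m0 \<Longrightarrow> Y \<omega> - e \<le> X k \<omega>"
        using order_tendstoD(1)[OF elim(1), of "Y \<omega> - e"]
        by (auto simp: eventually_sequentially intro: less_imp_le)
      have "Y \<omega> - e \<le> wealth (V m) T \<omega>" if "m \<ge> m0" for m
        using elim(3) m0 that by (meson order_trans)
      then have "Y \<omega> - e \<le> wealth N' T \<omega>"
        using elim(2) by (blast intro: LIMSEQ_le_const)
      then show "Y \<omega> \<le> wealth N' T \<omega> + e" by simp
    qed
  qed
  with N'(1) Y show ?thesis by (auto simp: attainable_iff)
qed

theorem attainable_closed: "closed_in_probability P (attainable P F T S r \<alpha>)"
  unfolding closed_in_probability_def
proof (intro allI impI, elim conjE)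
  fix X :: "nat \<Rightarrow> 'a \<Rightarrow> real" and Y
  assume X: "\<forall>n. X n \<in> attainable P F T S r \<alpha>" and Y: "Y \<in> borel_measurable P"
    and lim: "tendsto_in_probability P X Y"
  have "X n \<in> borel_measurable P" for n
    using X attainable_iff by blast
  then obtain j :: "nat \<Rightarrow> nat" where "AE \<omega> in P. (\<lambda>n. X (j n) \<omega>) \<longlonglongrightarrow> Y \<omega>"
    using tendsto_in_probability_AE_subseq[OF _ Y lim] by blast
  with X Y show "Y \<in> attainable P F T S r \<alpha>"
    by (intro attainable_closed_AE[of "\<lambda>n. X (j n)" Y]) simp_all
qed


section \<open>The separating measure\<close>

text \<open>A strictly positive weight does not change which events are charged. On the
  \<open>F u\<close>-event where the conditional expectation is at most 0, the nonnegative weighted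
  indicator integrates to 0, so this event excludes the down move and is null.\<close>

lemma cond_exp_down_move_pos:
  assumes "u < T" and [measurable]: "R \<in> borel_measurable P" and R: "\<And>\<omega>. 0 < R \<omega>" "\<And>\<omega>. R \<omega> \<le> 1"
  defines "B \<equiv> {\<omega> \<in> space P. S (Suc u) \<omega> \<le> growth * S u \<omega>}"
  shows "AE \<omega> in P. 0 < real_cond_exp P (F u) (\<lambda>\<omega>. indicator B \<omega> * R \<omega>) \<omega>"
proof -
  interpret Fu: finite_measure_subalgebra P "F u"
    using \<open>u < T\<close> by unfold_locales (simp add: subalg)
  let ?p = "real_cond_exp P (F u) (\<lambda>\<omega>. indicator B \<omega> * R \<omega>)"
  define A where "A = {\<omega> \<in> space (F u). ?p \<omega> \<le> 0}"
  have [measurable]: "S u \<in> borel_measurable P" "S (Suc u) \<in> borel_measurable P"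
    using S_measurable \<open>u < T\<close> by simp_all
  have [measurable]: "B \<in> sets P"
    unfolding B_def by measurable
  have A: "A \<in> sets (F u)"
    unfolding A_def by measurable
  then have [measurable]: "A \<in> sets P"
    using subalg[of u] \<open>u < T\<close> by (auto simp: subalgebra_def)
  have int: "integrable P (\<lambda>\<omega>. indicator A \<omega> * (indicator B \<omega> * R \<omega>))"
    by (rule integrable_const_bound[of _ 1])
      (use R in \<open>auto simp: indicator_def less_imp_le\<close>)
  have "(\<integral>\<omega>. indicator A \<omega> * (indicator B \<omega> * R \<omega>) \<partial>P) = (\<integral>\<omega>. indicator A \<omega> * ?p \<omega> \<partial>P)"
    using int A by (intro Fu.real_cond_exp_intg(2)[symmetric]) auto
  also have "\<dots> \<le> 0"
  proof -
    have "0 \<le> (\<integral>\<omega>. - (indicator A \<omega> * ?p \<omega>) \<partial>P)"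
      by (intro integral_nonneg_AE AE_I2) (auto simp: A_def indicator_def)
    then show ?thesis by simp
  qed
  finally have "(\<integral>\<omega>. indicator A \<omega> * (indicator B \<omega> * R \<omega>) \<partial>P) = 0"
    by (intro antisym integral_nonneg_AE AE_I2) (use R in \<open>auto simp: indicator_def less_imp_le\<close>)
  then have "AE \<omega> in P. indicator A \<omega> * (indicator B \<omega> * R \<omega>) = 0"
    using R by (subst (asm) integral_nonneg_eq_0_iff_AE[OF int]) (auto simp: indicator_def less_imp_le)
  then have "AE \<omega> in P. \<omega> \<in> A \<longrightarrow> \<not> S (Suc u) \<omega> \<le> (1 + (1 - \<alpha>) * r) * S u \<omega>"
    using AE_space
  proof (eventually_elim, intro impI notI)
    fix \<omega>
    assume "indicator A \<omega> * (indicator B \<omega> * R \<omega>) = 0" "\<omega> \<in> A" "\<omega> \<in> space P"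
      "S (Suc u) \<omega> \<le> (1 + (1 - \<alpha>) * r) * S u \<omega>"
    then show False using R(1)[of \<omega>] by (simp add: B_def growth_def)
  qed
  then have "AE \<omega> in P. \<omega> \<notin> A"
    using down_moves A \<open>u < T\<close> by blast
  with AE_space show ?thesis
    by eventually_elim (use space_F[of u] \<open>u < T\<close> in \<open>auto simp: A_def not_le\<close>)
qed

text \<open>The one-step density is 1 on the down move and so small on its complement that the expected
  gain there is compensated by the slack on the down move. Here \<open>R\<close> is the density of the
  later steps.\<close>

lemma one_step_density:
  assumes "u < T" and R_meas [measurable]: "R \<in> borel_measurable P"
    and R: "\<And>\<omega>. 0 < R \<omega>" "\<And>\<omega>. R \<omega> \<le> 1"
  obtains f where "f \<in> borel_measurable (F (Suc u))" "\<And>\<omega>. 0 < f \<omega>" "\<And>\<omega>. f \<omega> \<le> 1"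
    "AE \<omega> in P. f \<omega> * (1 + S (Suc u) \<omega>) \<le> (1 + growth) * (1 + S u \<omega>)"
    "\<And>h K i. h \<in> borel_measurable (F u) \<Longrightarrow> AE \<omega> in P. 0 \<le> h \<omega> \<and> h \<omega> * (1 + S u \<omega>) \<le> K \<Longrightarrow> i \<le> u \<Longrightarrow>
      (\<integral>\<omega>. h \<omega> * (f \<omega> * R \<omega>) * excess i u \<omega> \<partial>P) \<le> 0"
proof -
  interpret Fu: finite_measure_subalgebra P "F u"
    using \<open>u < T\<close> by unfold_locales (simp add: subalg)
  define B where "B = {\<omega> \<in> space P. S (Suc u) \<omega> \<le> growth * S u \<omega>}"
  define g where "g \<omega> = indicator B \<omega> * R \<omega>" for \<omega>
  define p where "p = real_cond_exp P (F u) g"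
  \<comment> \<open>The slack of every lot \<open>i \<le> u\<close> is at least
    \<open>slack * m\<close>, so compensating with \<open>m\<close> treats all lots by one
    density.\<close>
  define m where "m \<omega> = Min ((\<lambda>s. S s \<omega>) ` {..u})" for \<omega>
  \<comment> \<open>The default 1 only ensures positivity: up to a null set it occurs only for
    \<open>S u \<omega> = 0\<close>, where the price stays 0 and \<open>f\<close> does not use
    \<open>\<epsilon>\<close>.\<close>
  define \<epsilon> where "\<epsilon> \<omega> = (if 0 < slack * m \<omega> * p \<omega> then min 1 (slack * m \<omega> * p \<omega>) else 1)" for \<omega>
  define f where "f \<omega> = (if S (Suc u) \<omega> \<le> growth * S u \<omega> then 1 else \<epsilon> \<omega> / (1 + \<bar>S (Suc u) \<omega>\<bar>))" for \<omega>

  have [measurable]: "S u \<in> borel_measurable P" "S (Suc u) \<in> borel_measurable P"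
    using S_measurable \<open>u < T\<close> by simp_all
  have B_meas [measurable]: "B \<in> sets P"
    unfolding B_def by measurable
  have g_meas [measurable]: "g \<in> borel_measurable P"
    unfolding g_def[abs_def] by measurable
  have p_pos: "AE \<omega> in P. 0 < p \<omega>"
    using cond_exp_down_move_pos[OF \<open>u < T\<close> R_meas R] by (simp add: p_def g_def[abs_def] B_def)
  have m_meas: "m \<in> borel_measurable (F u)"
    unfolding m_def[abs_def] using \<open>u < T\<close> S_measurable_F by (intro borel_measurable_Min) auto
  have p_meas: "p \<in> borel_measurable (F u)"
    unfolding p_def by simp
  have [measurable]: "m \<in> borel_measurable (F (Suc u))" "p \<in> borel_measurable (F (Suc u))"
    "S u \<in> borel_measurable (F (Suc u))" "S (Suc u) \<in> borel_measurable (F (Suc u))"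
    using measurable_F_mono[OF m_meas, of "Suc u"] measurable_F_mono[OF p_meas, of "Suc u"]
      S_measurable_F \<open>u < T\<close> by auto
  have m_le: "m \<omega> \<le> S s \<omega>" if "s \<le> u" for s \<omega>
    unfolding m_def using that by (intro Min_le) auto
  have m_nonneg: "AE \<omega> in P. 0 \<le> m \<omega>"
    using AE_S_nonneg by eventually_elim (use \<open>u < T\<close> in \<open>auto simp: m_def\<close>)
  have m_pos: "AE \<omega> in P. 0 < S u \<omega> \<longrightarrow> 0 < m \<omega>"
    using AE_S_nonneg AE_zero_absorbing
  proof (eventually_elim, intro impI)
    fix \<omega>
    assume nonneg: "\<forall>t\<le>T. 0 \<le> S t \<omega>"
      and absorb: "\<forall>s u. s \<le> u \<longrightarrow> u \<le> T \<longrightarrow> S s \<omega> = 0 \<longrightarrow> S u \<omega> = 0" and "0 < S u \<omega>"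
    have "0 < S s \<omega>" if "s \<le> u" for s
      using nonneg[rule_format, of s] absorb[rule_format, of s u] that \<open>u < T\<close> \<open>0 < S u \<omega>\<close>
      by (cases "S s \<omega> = 0") auto
    then show "0 < m \<omega>" by (auto simp: m_def)
  qed
  have \<epsilon>: "0 < \<epsilon> \<omega>" "\<epsilon> \<omega> \<le> 1" for \<omega>
    by (auto simp: \<epsilon>_def)
  have f_pos: "0 < f \<omega>" for \<omega>
    using \<epsilon>(1)[of \<omega>] by (auto simp: f_def intro!: divide_pos_pos add_pos_nonneg)
  have f_le: "f \<omega> \<le> 1" for \<omega>
    using \<epsilon>(2)[of \<omega>] by (auto simp: f_def)
  have f_meas: "f \<in> borel_measurable (F (Suc u))"
    unfolding f_def[abs_def] \<epsilon>_def[abs_def] by measurable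
  have f_up: "f \<omega> * S (Suc u) \<omega> \<le> \<epsilon> \<omega>" if "growth * S u \<omega> < S (Suc u) \<omega>" "0 \<le> S (Suc u) \<omega>" for \<omega>
    using that \<epsilon>(1)[of \<omega>] by (auto simp: f_def field_simps)

  \<comment> \<open>On a down move the left side is at most
    \<open>1 + growth * S u \<omega>\<close>, otherwise at most
    \<open>1 + \<epsilon> \<omega> \<le> 2\<close>. This estimate replaces moment assumptions when
    densities are multiplied.\<close>
  have "AE \<omega> in P. f \<omega> * (1 + S (Suc u) \<omega>) \<le> (1 + growth) * (1 + S u \<omega>)"
    using AE_S_nonneg
  proof eventually_elim
    case (elim \<omega>)
    then have nonneg: "0 \<le> S u \<omega>" "0 \<le> S (Suc u) \<omega>" using \<open>u < T\<close> by auto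
    have "0 \<le> growth * S u \<omega>"
      using nonneg growth_ge_1 by simp
    then have "1 + S u \<omega> + growth + growth * S u \<omega> \<ge> 2"
      using nonneg growth_ge_1 by linarith
    moreover have "f \<omega> * (1 + S (Suc u) \<omega>) \<le> 1 + growth * S u \<omega> \<or> f \<omega> * (1 + S (Suc u) \<omega>) \<le> 2"
    proof (cases "S (Suc u) \<omega> \<le> growth * S u \<omega>")
      case False
      then show ?thesis
        using f_up[of \<omega>] nonneg \<epsilon>(2)[of \<omega>] f_le[of \<omega>] by (auto simp: distrib_left)
    qed (simp add: f_def)
    moreover have "(1 + growth) * (1 + S u \<omega>) = 1 + S u \<omega> + growth + growth * S u \<omega>"
      by (simp add: algebra_simps)
    ultimately show ?case
      using nonneg growth_ge_1 by linarith
  qed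
  moreover
  have "(\<integral>\<omega>. h \<omega> * (f \<omega> * R \<omega>) * excess i u \<omega> \<partial>P) \<le> 0"
    if h: "h \<in> borel_measurable (F u)"
      and h_bound: "AE \<omega> in P. 0 \<le> h \<omega> \<and> h \<omega> * (1 + S u \<omega>) \<le> K" and "i \<le> u" for h K i
  \<comment> \<open>A non-integrable function has integral 0 by convention, so only the integrable
    case has content.\<close>
  proof (cases "integrable P (\<lambda>\<omega>. h \<omega> * (f \<omega> * R \<omega>) * excess i u \<omega>)")
    case True
    have [measurable]: "h \<in> borel_measurable P" "m \<in> borel_measurable P"
      using measurable_F_P[OF h] measurable_F_P[OF m_meas] \<open>u < T\<close> by auto
    have hm_meas: "(\<lambda>\<omega>. h \<omega> * (slack * m \<omega>)) \<in> borel_measurable (F u)"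
      using h m_meas by measurable
    have int: "integrable P (\<lambda>\<omega>. h \<omega> * (slack * m \<omega>) * g \<omega>)"
    proof (rule integrable_const_bound[of _ "slack * K"])
      show "AE \<omega> in P. norm (h \<omega> * (slack * m \<omega>) * g \<omega>) \<le> slack * K"
        using h_bound m_nonneg
      proof eventually_elim
        case (elim \<omega>)
        have "h \<omega> * m \<omega> \<le> h \<omega> * (1 + S u \<omega>)"
          using elim m_le[of u \<omega>] by (intro mult_left_mono) auto
        then have "h \<omega> * m \<omega> \<le> K" using elim by linarith
        moreover have "0 \<le> g \<omega>" "g \<omega> \<le> 1"
          using R[of \<omega>] by (auto simp: g_def indicator_def less_imp_le)
        moreover have "0 \<le> h \<omega> * m \<omega>" using elim by simp
        ultimately have "h \<omega> * m \<omega> * g \<omega> \<le> K * 1" "0 \<le> h \<omega> * m \<omega> * g \<omega>"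
          by (intro mult_mono, auto)
        then have "slack * (h \<omega> * m \<omega> * g \<omega>) \<le> slack * K" "0 \<le> slack * (h \<omega> * m \<omega> * g \<omega>)"
          using slack_pos by simp_all
        then show ?case by (simp add: mult_ac)
      qed
    qed measurable
    note cond = Fu.real_cond_exp_intg[OF int hm_meas g_meas, folded p_def]
    \<comment> \<open>The term with \<open>p\<close> bounds the gain on an up move, the term with
      \<open>g\<close> the slack guaranteed on a down move. Since \<open>p\<close> is the
      conditional expectation of \<open>g\<close> and their common factor is measurable for
      \<open>F u\<close>, the two integrals cancel.\<close>
    have "(\<integral>\<omega>. h \<omega> * (f \<omega> * R \<omega>) * excess i u \<omega> \<partial>P)
        \<le> (\<integral>\<omega>. h \<omega> * (slack * m \<omega>) * p \<omega> - h \<omega> * (slack * m \<omega>) * g \<omega> \<partial>P)"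
    proof (rule integral_mono_AE[OF True])
      show "integrable P (\<lambda>\<omega>. h \<omega> * (slack * m \<omega>) * p \<omega> - h \<omega> * (slack * m \<omega>) * g \<omega>)"
        using cond(1) int by (rule Bochner_Integration.integrable_diff)
      show "AE \<omega> in P. h \<omega> * (f \<omega> * R \<omega>) * excess i u \<omega>
          \<le> h \<omega> * (slack * m \<omega>) * p \<omega> - h \<omega> * (slack * m \<omega>) * g \<omega>"
        using h_bound m_nonneg m_pos p_pos AE_S_nonneg AE_zero_absorbing
      proof eventually_elim
        case (elim \<omega>)
        then have nonneg: "0 \<le> S u \<omega>" "0 \<le> S (Suc u) \<omega>" using \<open>u < T\<close> by auto
        have up: "f \<omega> * R \<omega> * (S (Suc u) \<omega> - growth * S u \<omega>) \<le> slack * m \<omega> * p \<omega>"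
        proof (cases "S (Suc u) \<omega> \<le> growth * S u \<omega>")
          case True
          then have "f \<omega> * R \<omega> * (S (Suc u) \<omega> - growth * S u \<omega>) \<le> 0"
            using f_pos[of \<omega>] R(1)[of \<omega>] by (intro mult_nonneg_nonpos) auto
          moreover have "0 \<le> slack * m \<omega> * p \<omega>"
            using slack_pos elim by simp
          ultimately show ?thesis by linarith
        next
          case False
          have "S u \<omega> \<noteq> 0"
          proof
            assume "S u \<omega> = 0"
            moreover have "S (Suc u) \<omega> = 0"
              using elim(6)[rule_format, of u "Suc u"] \<open>S u \<omega> = 0\<close> \<open>u < T\<close> by simp
            ultimately show False using False by simp
          qed
          then have "0 < slack * m \<omega> * p \<omega>"
            using elim nonneg slack_pos by simp
          then have "\<epsilon> \<omega> \<le> slack * m \<omega> * p \<omega>" by (simp add: \<epsilon>_def)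
          moreover have "R \<omega> * (f \<omega> * (S (Suc u) \<omega> - growth * S u \<omega>)) \<le> 1 * \<epsilon> \<omega>"
          proof (rule mult_mono)
            have "0 \<le> f \<omega> * (growth * S u \<omega>)"
              using f_pos[of \<omega>] nonneg growth_ge_1 by simp
            then show "f \<omega> * (S (Suc u) \<omega> - growth * S u \<omega>) \<le> \<epsilon> \<omega>"
              using f_up[of \<omega>] False nonneg by (simp add: right_diff_distrib)
          qed (use R[of \<omega>] f_pos[of \<omega>] False in auto)
          ultimately show ?thesis by (simp add: mult_ac)
        qed
        \<comment> \<open>On the down move \<open>f\<close> is 1 and equality holds; elsewhere
          \<open>g\<close> vanishes.\<close>
        have "g \<omega> \<le> f \<omega> * R \<omega>"
          using f_pos[of \<omega>] R(1)[of \<omega>] by (auto simp: g_def indicator_def f_def B_def)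
        then have "m \<omega> * g \<omega> \<le> S i \<omega> * (f \<omega> * R \<omega>)"
          using m_le[OF \<open>i \<le> u\<close>, of \<omega>] elim R(1)[of \<omega>]
          by (intro mult_mono) (auto simp: g_def indicator_def less_imp_le)
        then have "slack * (m \<omega> * g \<omega>) \<le> slack * (S i \<omega> * (f \<omega> * R \<omega>))"
          using slack_pos by simp
        then have "f \<omega> * R \<omega> * excess i u \<omega> \<le> slack * m \<omega> * p \<omega> - slack * m \<omega> * g \<omega>"
          using up by (simp add: excess_def algebra_simps)
        then have "h \<omega> * (f \<omega> * R \<omega> * excess i u \<omega>) \<le> h \<omega> * (slack * m \<omega> * p \<omega> - slack * m \<omega> * g \<omega>)"
          using elim by (intro mult_left_mono) auto
        then show ?case by (simp add: right_diff_distrib mult_ac)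
      qed
    qed
    also have "\<dots> = 0"
      using cond int by simp
    finally show ?thesis .
  qed (simp add: not_integrable_integral_eq)
  ultimately show thesis
    using that[of f] f_meas f_pos f_le by blast
qed

text \<open>In the backward step \<open>R\<close> is multiplied by a one-step factor
  \<open>f\<close>. At the new date \<open>u\<close> the factor \<open>R\<close> sits inside the
  conditional expectation; at later dates \<open>f\<close> is already known and moves into the test
  function, hence the general \<open>h\<close>. The class \<open>h * (1 + S u) \<le> K\<close> is
  stable under this move by the bound on \<open>f * (1 + S (Suc u))\<close>.\<close>

lemma exists_density:
  assumes "u \<le> T"
  shows "\<exists>R. R \<in> borel_measurable P \<and> (\<forall>\<omega>. 0 < R \<omega> \<and> R \<omega> \<le> 1) \<and>
    (\<forall>v. u \<le> v \<longrightarrow> v \<le> T \<longrightarrow> (\<exists>C\<ge>0. AE \<omega> in P. R \<omega> * S v \<omega> \<le> C * (1 + S u \<omega>))) \<and>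
    (\<forall>v h K i. u \<le> v \<longrightarrow> v < T \<longrightarrow> h \<in> borel_measurable (F v) \<longrightarrow>
      (AE \<omega> in P. 0 \<le> h \<omega> \<and> h \<omega> * (1 + S u \<omega>) \<le> K) \<longrightarrow> i \<le> v \<longrightarrow>
      (\<integral>\<omega>. h \<omega> * R \<omega> * excess i v \<omega> \<partial>P) \<le> 0)"
  using assms
proof (induction u rule: inc_induct)
  case base
  show ?case
    by (intro exI[of _ "\<lambda>_. 1"]) (auto intro!: exI[of _ 1])
next
  case (step u)
  then obtain R where R_meas [measurable]: "R \<in> borel_measurable P"
    and R: "\<And>\<omega>. 0 < R \<omega>" "\<And>\<omega>. R \<omega> \<le> 1"
    and R_bound: "\<And>v. Suc u \<le> v \<Longrightarrow> v \<le> T \<Longrightarrow> \<exists>C\<ge>0. AE \<omega> in P. R \<omega> * S v \<omega> \<le> C * (1 + S (Suc u) \<omega>)"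
    and R_excess: "\<And>v h K i. Suc u \<le> v \<Longrightarrow> v < T \<Longrightarrow> h \<in> borel_measurable (F v) \<Longrightarrow>
      AE \<omega> in P. 0 \<le> h \<omega> \<and> h \<omega> * (1 + S (Suc u) \<omega>) \<le> K \<Longrightarrow> i \<le> v \<Longrightarrow>
      (\<integral>\<omega>. h \<omega> * R \<omega> * excess i v \<omega> \<partial>P) \<le> 0"
    by blast
  obtain f where f_meas: "f \<in> borel_measurable (F (Suc u))" and f: "\<And>\<omega>. 0 < f \<omega>" "\<And>\<omega>. f \<omega> \<le> 1"
    and f_bound: "AE \<omega> in P. f \<omega> * (1 + S (Suc u) \<omega>) \<le> (1 + growth) * (1 + S u \<omega>)"
    and f_excess: "\<And>h K i. h \<in> borel_measurable (F u) \<Longrightarrow>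
      AE \<omega> in P. 0 \<le> h \<omega> \<and> h \<omega> * (1 + S u \<omega>) \<le> K \<Longrightarrow> i \<le> u \<Longrightarrow>
      (\<integral>\<omega>. h \<omega> * (f \<omega> * R \<omega>) * excess i u \<omega> \<partial>P) \<le> 0"
    using one_step_density[OF \<open>u < T\<close> R_meas R] by blast
  have [measurable]: "f \<in> borel_measurable P"
    using measurable_F_P[OF f_meas] \<open>u < T\<close> by simp
  show ?case
  proof (intro exI[of _ "\<lambda>\<omega>. f \<omega> * R \<omega>"] conjI allI impI)
    show "(\<lambda>\<omega>. f \<omega> * R \<omega>) \<in> borel_measurable P" by measurable
    show "0 < f \<omega> * R \<omega>" for \<omega> using f R by simp
    show "f \<omega> * R \<omega> \<le> 1" for \<omega>
      using f[of \<omega>] R[of \<omega>] by (intro mult_le_one) auto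
  next
    fix v assume "u \<le> v" "v \<le> T"
    show "\<exists>C\<ge>0. AE \<omega> in P. f \<omega> * R \<omega> * S v \<omega> \<le> C * (1 + S u \<omega>)"
    proof (cases "v = u")
      case True
      have "AE \<omega> in P. f \<omega> * R \<omega> * S v \<omega> \<le> 1 * (1 + S u \<omega>)"
        using AE_S_nonneg
      proof eventually_elim
        case (elim \<omega>)
        have "f \<omega> * R \<omega> * S v \<omega> \<le> 1 * S v \<omega>"
          using elim \<open>v \<le> T\<close> f[of \<omega>] R[of \<omega>] by (intro mult_right_mono mult_le_one) auto
        then show ?case using True by simp
      qed
      then show ?thesis by (intro exI[of _ 1]) simp
    next
      case False
      with \<open>u \<le> v\<close> have "Suc u \<le> v" by simp
      from R_bound[OF this \<open>v \<le> T\<close>] obtain C where "0 \<le> C"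
        and C: "AE \<omega> in P. R \<omega> * S v \<omega> \<le> C * (1 + S (Suc u) \<omega>)" by blast
      have "AE \<omega> in P. f \<omega> * R \<omega> * S v \<omega> \<le> C * (1 + growth) * (1 + S u \<omega>)"
        using C f_bound
      proof eventually_elim
        case (elim \<omega>)
        have "f \<omega> * (R \<omega> * S v \<omega>) \<le> f \<omega> * (C * (1 + S (Suc u) \<omega>))"
          using elim f[of \<omega>] by (intro mult_left_mono) auto
        also have "\<dots> = C * (f \<omega> * (1 + S (Suc u) \<omega>))"
          by (simp add: mult_ac)
        also have "\<dots> \<le> C * ((1 + growth) * (1 + S u \<omega>))"
          using elim \<open>0 \<le> C\<close> by (intro mult_left_mono) auto
        finally show ?case by (simp add: mult_ac)
      qed
      moreover have "0 \<le> C * (1 + growth)" using \<open>0 \<le> C\<close> growth_ge_1 by simp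
      ultimately show ?thesis by blast
    qed
  next
    fix v h K i
    assume "u \<le> v" "v < T" and h: "h \<in> borel_measurable (F v)"
      and h_bound: "AE \<omega> in P. 0 \<le> h \<omega> \<and> h \<omega> * (1 + S u \<omega>) \<le> K" and "i \<le> v"
    show "(\<integral>\<omega>. h \<omega> * (f \<omega> * R \<omega>) * excess i v \<omega> \<partial>P) \<le> 0"
    proof (cases "v = u")
      case True
      then show ?thesis using f_excess[of h K i] h h_bound \<open>i \<le> v\<close> by simp
    next
      case False
      with \<open>u \<le> v\<close> have "Suc u \<le> v" by simp
      have "f \<in> borel_measurable (F v)"
        using measurable_F_mono[OF f_meas \<open>Suc u \<le> v\<close>] \<open>v < T\<close> by simp
      with h have "(\<lambda>\<omega>. h \<omega> * f \<omega>) \<in> borel_measurable (F v)" by measurable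
      moreover have "AE \<omega> in P. 0 \<le> h \<omega> * f \<omega> \<and> h \<omega> * f \<omega> * (1 + S (Suc u) \<omega>) \<le> (1 + growth) * K"
        using h_bound f_bound
      proof eventually_elim
        case (elim \<omega>)
        have "h \<omega> * (f \<omega> * (1 + S (Suc u) \<omega>)) \<le> h \<omega> * ((1 + growth) * (1 + S u \<omega>))"
          using elim by (intro mult_left_mono) auto
        also have "\<dots> = (1 + growth) * (h \<omega> * (1 + S u \<omega>))"
          by (simp add: mult_ac)
        also have "\<dots> \<le> (1 + growth) * K"
          using elim growth_ge_1 by (intro mult_left_mono) auto
        finally show ?case
          using elim f(1)[of \<omega>] by (simp add: mult.assoc)
      qed
      ultimately have "(\<integral>\<omega>. h \<omega> * f \<omega> * R \<omega> * excess i v \<omega> \<partial>P) \<le> 0"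
        using R_excess[OF \<open>Suc u \<le> v\<close> \<open>v < T\<close>] \<open>i \<le> v\<close> by blast
      then show ?thesis by (simp add: mult.assoc)
    qed
  qed
qed

text \<open>At \<open>t = i\<close> there is no gain to tax, and each further period adds the
  discounted excess. A sale at a random date thus becomes a sum of one-period terms.\<close>

lemma discounted_sale_telescope:
  assumes "i \<le> t"
  shows "(S t \<omega> - \<alpha> * (S t \<omega> - S i \<omega>)) / growth ^ t
    = S i \<omega> / growth ^ i + (\<Sum>v\<in>{i..<t}. (1 - \<alpha>) * excess i v \<omega> / growth ^ Suc v)"
  using assms
proof (induction t rule: dec_induct)
  case base
  show ?case by simp
next
  case (step t)
  have "(S t \<omega> - \<alpha> * (S t \<omega> - S i \<omega>)) / growth ^ t
      = growth * (S t \<omega> - \<alpha> * (S t \<omega> - S i \<omega>)) / growth ^ Suc t"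
    using growth_ge_1 by simp
  moreover have "growth * (S t \<omega> - \<alpha> * (S t \<omega> - S i \<omega>)) + (1 - \<alpha>) * excess i t \<omega>
      = S (Suc t) \<omega> - \<alpha> * (S (Suc t) \<omega> - S i \<omega>)"
    unfolding excess_def slack_def growth_def by algebra
  ultimately have "(S (Suc t) \<omega> - \<alpha> * (S (Suc t) \<omega> - S i \<omega>)) / growth ^ Suc t
      = (S t \<omega> - \<alpha> * (S t \<omega> - S i \<omega>)) / growth ^ t + (1 - \<alpha>) * excess i t \<omega> / growth ^ Suc t"
    by (simp only: flip: add_divide_distrib)
  with step show ?case by simp
qed

theorem exists_separating_measure:
  "\<exists>Q. prob_space Q \<and> equivalent_measure P Q \<and>
    (\<exists>C::real. AE \<omega> in P. RN_deriv P Q \<omega> \<le> ennreal C) \<and>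
    (\<forall>i\<le>T. integrable Q (S i)) \<and>
    (\<forall>i<T. \<forall>\<tau>\<in>stopping_times P F T i.
      (\<integral>\<omega>. (S (\<tau> \<omega>) \<omega> - \<alpha> * (S (\<tau> \<omega>) \<omega> - S i \<omega>)) / growth ^ \<tau> \<omega> \<partial>Q)
        \<le> (\<integral>\<omega>. S i \<omega> / growth ^ i \<partial>Q))"
proof -
  from exists_density[OF le0] obtain R where [measurable]: "R \<in> borel_measurable P"
    and R01: "\<forall>\<omega>. 0 < R \<omega> \<and> R \<omega> \<le> 1"
    and R_bound: "\<forall>v. 0 \<le> v \<longrightarrow> v \<le> T \<longrightarrow> (\<exists>C\<ge>0. AE \<omega> in P. R \<omega> * S v \<omega> \<le> C * (1 + S 0 \<omega>))"
    and R_excess: "\<forall>v h K i. 0 \<le> v \<longrightarrow> v < T \<longrightarrow> h \<in> borel_measurable (F v) \<longrightarrow>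
      (AE \<omega> in P. 0 \<le> h \<omega> \<and> h \<omega> * (1 + S 0 \<omega>) \<le> K) \<longrightarrow> i \<le> v \<longrightarrow>
      (\<integral>\<omega>. h \<omega> * R \<omega> * excess i v \<omega> \<partial>P) \<le> 0"
    by (elim exE conjE) (rule that)
  have R: "0 < R \<omega>" "R \<omega> \<le> 1" for \<omega>
    using R01 by simp_all
  \<comment> \<open>The bounds for \<open>R\<close> refer to the possibly random and non-integrable
    initial price; this damping makes every \<open>D * S v\<close> bounded. The absolute value keeps
    \<open>D\<close> positive everywhere, as \<open>S 0\<close> is nonnegative only almost
    surely.\<close>
  define D where "D \<omega> = R \<omega> / (1 + \<bar>S 0 \<omega>\<bar>)" for \<omega>
  have [measurable]: "D \<in> borel_measurable P"
    unfolding D_def[abs_def] by measurable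
  have D_pos: "0 < D \<omega>" for \<omega>
    using R by (simp add: D_def add_pos_nonneg)
  have D_le: "D \<omega> \<le> 1" for \<omega>
    using R(2)[of \<omega>] by (simp add: D_def)
  have D_int: "integrable P D"
    by (rule integrable_const_bound[of _ 1]) (use D_le D_pos in \<open>auto simp: less_imp_le\<close>)
  define z where "z = (\<integral>\<omega>. D \<omega> \<partial>P)"
  have "0 < z"
  proof -
    have "z \<noteq> 0"
    proof
      assume "z = 0"
      then have "AE \<omega> in P. D \<omega> = 0"
        unfolding z_def using D_pos
        by (subst (asm) integral_nonneg_eq_0_iff_AE[OF D_int]) (auto simp: less_imp_le)
      then have "AE \<omega> in P. False"
        by eventually_elim (use D_pos in \<open>simp add: less_imp_neq[symmetric]\<close>)
      then show False by simp
    qed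
    moreover have "0 \<le> z"
      unfolding z_def using D_pos by (intro integral_nonneg_AE) (auto simp: less_imp_le)
    ultimately show ?thesis by simp
  qed
  define \<rho> where "\<rho> \<omega> = D \<omega> / z" for \<omega>
  have [measurable]: "\<rho> \<in> borel_measurable P"
    unfolding \<rho>_def[abs_def] by measurable
  have \<rho>_pos: "0 < \<rho> \<omega>" for \<omega>
    using D_pos \<open>0 < z\<close> by (simp add: \<rho>_def)
  have \<rho>_le: "\<rho> \<omega> \<le> 1 / z" for \<omega>
    using D_le \<open>0 < z\<close> by (simp add: \<rho>_def divide_right_mono)
  define Q where "Q = density P (\<lambda>\<omega>. ennreal (\<rho> \<omega>))"
  have sets_Q [simp, measurable_cong]: "sets Q = sets P" and space_Q [simp]: "space Q = space P"
    by (simp_all add: Q_def)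
  have integrable_Q: "integrable Q X \<longleftrightarrow> integrable P (\<lambda>\<omega>. \<rho> \<omega> * X \<omega>)"
    and integral_Q: "(\<integral>\<omega>. X \<omega> \<partial>Q) = (\<integral>\<omega>. \<rho> \<omega> * X \<omega> \<partial>P)"
    if "X \<in> borel_measurable P" for X :: "'a \<Rightarrow> real"
    using that \<rho>_pos unfolding Q_def
    by (simp_all add: integrable_density integral_density less_imp_le)
  have AE_Q: "(AE \<omega> in Q. X \<omega>) \<longleftrightarrow> (AE \<omega> in P. X \<omega>)" for X
    unfolding Q_def using \<rho>_pos by (subst AE_density) auto

  have "prob_space Q"
  proof (rule prob_spaceI)
    have "emeasure Q (space Q) = (\<integral>\<^sup>+\<omega>. ennreal (\<rho> \<omega>) \<partial>P)"
      unfolding Q_def by (simp add: emeasure_density cong: nn_integral_cong)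
    also have "\<dots> = ennreal (\<integral>\<omega>. \<rho> \<omega> \<partial>P)"
      using D_int \<rho>_pos by (intro nn_integral_eq_integral) (auto simp: \<rho>_def[abs_def] less_imp_le)
    also have "(\<integral>\<omega>. \<rho> \<omega> \<partial>P) = 1"
      using \<open>0 < z\<close> by (simp add: \<rho>_def z_def)
    finally show "emeasure Q (space Q) = 1" by simp
  qed
  moreover have "equivalent_measure P Q"
    unfolding equivalent_measure_def
  proof (intro conjI)
    show "absolutely_continuous P Q" "absolutely_continuous Q P"
      unfolding absolutely_continuous_def null_sets_def
      using AE_Q AE_iff_null_sets[of _ P] AE_iff_null_sets[of _ Q] by (auto simp: null_sets_def)
  qed simp
  moreover have "\<exists>C::real. AE \<omega> in P. RN_deriv P Q \<omega> \<le> ennreal C"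
  proof
    have "AE \<omega> in P. ennreal (\<rho> \<omega>) = RN_deriv P Q \<omega>"
      by (rule RN_deriv_unique) (auto simp: Q_def)
    then show "AE \<omega> in P. RN_deriv P Q \<omega> \<le> ennreal (1 / z)"
      by eventually_elim (metis \<rho>_le ennreal_leI)
  qed
  moreover have S_int: "integrable Q (S v)" if "v \<le> T" for v
  proof -
    obtain C where "0 \<le> C" and C: "AE \<omega> in P. R \<omega> * S v \<omega> \<le> C * (1 + S 0 \<omega>)"
      using R_bound[rule_format, OF le0 \<open>v \<le> T\<close>] by blast
    have "integrable P (\<lambda>\<omega>. D \<omega> * S v \<omega>)"
    proof (rule integrable_const_bound[of _ C])
      show "AE \<omega> in P. norm (D \<omega> * S v \<omega>) \<le> C"
        using C AE_S_nonneg
      proof eventually_elim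
        case (elim \<omega>)
        then have "0 \<le> S 0 \<omega>" "0 \<le> S v \<omega>" using that by auto
        then have "D \<omega> * S v \<omega> \<le> C"
          using elim by (simp add: D_def pos_divide_le_eq add_pos_nonneg)
        then show ?case using D_pos[of \<omega>] \<open>0 \<le> S v \<omega>\<close> by (simp add: abs_mult)
      qed
      show "(\<lambda>\<omega>. D \<omega> * S v \<omega>) \<in> borel_measurable P" using that by measurable
    qed
    then show ?thesis
      using that by (simp add: integrable_Q \<rho>_def)
  qed
  moreover have "(\<integral>\<omega>. (S (\<tau> \<omega>) \<omega> - \<alpha> * (S (\<tau> \<omega>) \<omega> - S i \<omega>)) / growth ^ \<tau> \<omega> \<partial>Q)
      \<le> (\<integral>\<omega>. S i \<omega> / growth ^ i \<partial>Q)" if "i < T" and \<tau>: "\<tau> \<in> stopping_times P F T i" for i \<tau>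
  proof -
    \<comment> \<open>\<open>c v\<close> indicates that the share is still held after
      \<open>v\<close>. It replaces the random summation range by a fixed one and is known at
      \<open>v\<close>, being determined by \<open>\<tau> \<le> v\<close>.\<close>
    define c where "c v \<omega> = (if v < \<tau> \<omega> then 1 else 0 :: real)" for v \<omega>
    have c_meas: "c v \<in> borel_measurable (F v)" for v
    proof -
      have [measurable]: "Measurable.pred (F v) (\<lambda>\<omega>. \<tau> \<omega> \<le> v)"
        using \<tau> by (auto simp: stopping_times_def stopping_time_def)
      have "c v = (\<lambda>\<omega>. if \<tau> \<omega> \<le> v then 0 else 1)"
        by (auto simp: c_def fun_eq_iff)
      then show ?thesis by simp
    qed
    have summand: "integrable Q (\<lambda>\<omega>. c v \<omega> * excess i v \<omega>)" "(\<integral>\<omega>. c v \<omega> * excess i v \<omega> \<partial>Q) \<le> 0"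
      if "i \<le> v" "v < T" for v
    proof -
      have [measurable]: "c v \<in> borel_measurable P" "excess i v \<in> borel_measurable P"
        using measurable_F_P[OF c_meas] excess_measurable that by auto
      have "integrable Q (excess i v)"
        unfolding excess_def[abs_def] using S_int that \<open>i < T\<close> by auto
      then show "integrable Q (\<lambda>\<omega>. c v \<omega> * excess i v \<omega>)"
      proof (rule Bochner_Integration.integrable_bound)
        show "(\<lambda>\<omega>. c v \<omega> * excess i v \<omega>) \<in> borel_measurable Q" by measurable
      qed (simp add: c_def)
      \<comment> \<open>The damping in \<open>D\<close> is absorbed into the test function, which
        becomes admissible with \<open>K = 1\<close>.\<close>
      let ?h = "\<lambda>\<omega>. c v \<omega> / (1 + \<bar>S 0 \<omega>\<bar>)"
      have "S 0 \<in> borel_measurable (F v)" using S_measurable_F that by simp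
      with c_meas[of v] have "?h \<in> borel_measurable (F v)" by measurable
      moreover have "AE \<omega> in P. 0 \<le> ?h \<omega> \<and> ?h \<omega> * (1 + S 0 \<omega>) \<le> 1"
        using AE_S_nonneg by eventually_elim (auto simp: c_def)
      ultimately have nonpos: "(\<integral>\<omega>. ?h \<omega> * R \<omega> * excess i v \<omega> \<partial>P) \<le> 0"
        using R_excess that by blast
      have "(\<integral>\<omega>. c v \<omega> * excess i v \<omega> \<partial>Q) = (\<integral>\<omega>. ?h \<omega> * R \<omega> * excess i v \<omega> / z \<partial>P)"
        by (subst integral_Q) (auto simp: \<rho>_def D_def mult_ac)
      also have "\<dots> = (\<integral>\<omega>. ?h \<omega> * R \<omega> * excess i v \<omega> \<partial>P) / z"
        by (rule integral_divide_zero)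
      also have "\<dots> \<le> 0"
        using nonpos \<open>0 < z\<close> by (rule divide_nonpos_pos)
      finally show "(\<integral>\<omega>. c v \<omega> * excess i v \<omega> \<partial>Q) \<le> 0" .
    qed
    let ?a = "\<lambda>v. (1 - \<alpha>) / growth ^ Suc v"
    have eq: "(S (\<tau> \<omega>) \<omega> - \<alpha> * (S (\<tau> \<omega>) \<omega> - S i \<omega>)) / growth ^ \<tau> \<omega>
        = S i \<omega> / growth ^ i + (\<Sum>v\<in>{i..<T}. ?a v * (c v \<omega> * excess i v \<omega>))" if "\<omega> \<in> space Q" for \<omega>
    proof -
      have "i \<le> \<tau> \<omega>" "\<tau> \<omega> \<le> T" using that \<tau> by (auto simp: stopping_times_def)
      then have "(\<Sum>v\<in>{i..<\<tau> \<omega>}. (1 - \<alpha>) * excess i v \<omega> / growth ^ Suc v)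
          = (\<Sum>v\<in>{i..<T}. ?a v * (c v \<omega> * excess i v \<omega>))"
        by (intro sum.mono_neutral_cong_left) (auto simp: c_def)
      then show ?thesis using discounted_sale_telescope[OF \<open>i \<le> \<tau> \<omega>\<close>] by simp
    qed
    have "(\<integral>\<omega>. (S (\<tau> \<omega>) \<omega> - \<alpha> * (S (\<tau> \<omega>) \<omega> - S i \<omega>)) / growth ^ \<tau> \<omega> \<partial>Q)
        = (\<integral>\<omega>. S i \<omega> / growth ^ i + (\<Sum>v\<in>{i..<T}. ?a v * (c v \<omega> * excess i v \<omega>)) \<partial>Q)"
      by (rule Bochner_Integration.integral_cong[OF refl eq])
    also have "\<dots> = (\<integral>\<omega>. S i \<omega> / growth ^ i \<partial>Q)
        + (\<integral>\<omega>. (\<Sum>v\<in>{i..<T}. ?a v * (c v \<omega> * excess i v \<omega>)) \<partial>Q)"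
      using S_int \<open>i < T\<close> summand(1)
      by (intro Bochner_Integration.integral_add Bochner_Integration.integrable_sum integrable_mult_right) auto
    also have "(\<integral>\<omega>. (\<Sum>v\<in>{i..<T}. ?a v * (c v \<omega> * excess i v \<omega>)) \<partial>Q)
        = (\<Sum>v\<in>{i..<T}. \<integral>\<omega>. ?a v * (c v \<omega> * excess i v \<omega>) \<partial>Q)"
      using summand(1) by (intro Bochner_Integration.integral_sum integrable_mult_right) auto
    also have "\<dots> = (\<Sum>v\<in>{i..<T}. ?a v * (\<integral>\<omega>. c v \<omega> * excess i v \<omega> \<partial>Q))"
      by (intro sum.cong integral_mult_right_zero) auto
    also have "\<dots> \<le> 0"
      using summand(2) \<alpha>_less_1 growth_ge_1
      by (intro sum_nonpos mult_nonneg_nonpos) auto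
    finally show ?thesis by simp
  qed
  ultimately show ?thesis by blast
qed

end

section \<open>From conditional probabilities to the market assumptions\<close>

theorem proposition5p1:
  fixes P :: "'a measure" and F :: "nat \<Rightarrow> 'a measure" and T :: nat
    and S :: "nat \<Rightarrow> 'a \<Rightarrow> real" and r \<alpha> :: real
  assumes "prob_space P"
    and "filtration (space P) F"
    and "\<And>t. t \<le> T \<Longrightarrow> subalgebra P (F t)"
    and "T \<ge> 1"
    and "0 < \<alpha>" and "\<alpha> < 1" and "r > 0"
    and "\<And>t. t \<le> T \<Longrightarrow> S t \<in> L0_plus P (F t)"
    and "\<And>t. t \<in> {1..T} \<Longrightarrow>
           measure P {\<omega> \<in> space P. S (t - 1) \<omega> = 0 \<and> S t \<omega> > 0} = 0"
    (* x / 0 = 0 in HOL; by the preceding assumption only 0 / 0 occurs, up to a null set *)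
    and "\<And>t. t \<in> {1..T} \<Longrightarrow>
           AE \<omega> in P. conditional_probability P (F (t - 1))
             {\<omega>' \<in> space P. (S t \<omega>' - S (t - 1) \<omega>') / S (t - 1) \<omega>' \<le> (1 - \<alpha>) * r} \<omega> > 0"
  shows "closed_in_probability P (attainable P F T S r \<alpha>) \<and>
    (\<exists>Q. prob_space Q \<and> equivalent_measure P Q \<and>
       (\<exists>C::real. AE \<omega> in P. RN_deriv P Q \<omega> \<le> ennreal C) \<and>
       (\<forall>i\<le>T. integrable Q (S i)) \<and>
       (\<forall>i<T. \<forall>\<tau>\<in>stopping_times P F T i.
          (\<integral>\<omega>. (S (\<tau> \<omega>) \<omega> - \<alpha> * (S (\<tau> \<omega>) \<omega> - S i \<omega>)) / (1 + (1 - \<alpha>) * r) ^ \<tau> \<omega> \<partial>Q)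
            \<le> (\<integral>\<omega>. S i \<omega> / (1 + (1 - \<alpha>) * r) ^ i \<partial>Q)))"
proof -
  interpret prob_space P by fact
  have S_meas_F: "S t \<in> borel_measurable (F t)" and S_nonneg: "AE \<omega> in P. 0 \<le> S t \<omega>" if "t \<le> T" for t
    using assms(8)[OF that] by (auto simp: L0_plus_def)
  have S_meas: "S t \<in> borel_measurable P" if "t \<le> T" for t
    using measurable_from_subalg[OF assms(3)[OF that] S_meas_F[OF that]] .
  have absorb: "AE \<omega> in P. S t \<omega> = 0 \<longrightarrow> S (Suc t) \<omega> = 0" if "t < T" for t
  proof -
    have [measurable]: "S t \<in> borel_measurable P" "S (Suc t) \<in> borel_measurable P"
      using S_meas that by simp_all
    have "Measurable.pred P (\<lambda>\<omega>. \<not> (S t \<omega> = 0 \<and> S (Suc t) \<omega> > 0))"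
      by measurable
    moreover have "emeasure P {\<omega> \<in> space P. S t \<omega> = 0 \<and> S (Suc t) \<omega> > 0} = 0"
      using assms(9)[of "Suc t"] that by (simp add: emeasure_eq_measure)
    ultimately have "AE \<omega> in P. \<not> (S t \<omega> = 0 \<and> S (Suc t) \<omega> > 0)"
      by (subst AE_iff_measurable[OF _ refl]) (auto simp: pred_def)
    with S_nonneg[of "Suc t"] show ?thesis
      using that by (auto elim: eventually_elim2)
  qed
  have down: "AE \<omega> in P. \<omega> \<notin> A"
    if "t < T" and A: "A \<in> sets (F t)"
      and up: "AE \<omega> in P. \<omega> \<in> A \<longrightarrow> \<not> S (Suc t) \<omega> \<le> (1 + (1 - \<alpha>) * r) * S t \<omega>" for t A
  proof -
    interpret Ft: finite_measure_subalgebra P "F t"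
      using assms(3)[of t] \<open>t < T\<close> by unfold_locales simp
    define B where "B = {\<omega> \<in> space P. (S (Suc t) \<omega> - S t \<omega>) / S t \<omega> \<le> (1 - \<alpha>) * r}"
    have pos: "AE \<omega> in P. 0 < real_cond_exp P (F t) (indicator B) \<omega>"
      using assms(10)[of "Suc t"] \<open>t < T\<close> by (simp add: conditional_probability_def B_def)
    have [measurable]: "S t \<in> borel_measurable P" "S (Suc t) \<in> borel_measurable P"
      using S_meas \<open>t < T\<close> by simp_all
    have [measurable]: "B \<in> sets P"
      unfolding B_def by measurable
    have [measurable]: "A \<in> sets P"
      using A assms(3)[of t] \<open>t < T\<close> by (auto simp: subalgebra_def)
    have int: "integrable P (\<lambda>\<omega>. indicator A \<omega> * indicator B \<omega> :: real)"
      by (rule integrable_const_bound[of _ 1]) (auto simp: indicator_def)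
    note cond = Ft.real_cond_exp_intg[OF int borel_measurable_indicator[OF A] borel_measurable_indicator]
    \<comment> \<open>\<open>B\<close> lies almost surely in the down move: for a positive price by
      clearing the denominator, for price 0 because the next price is 0 as well.\<close>
    have "AE \<omega> in P. indicator A \<omega> * indicator B \<omega> = (0 :: real)"
      using up S_nonneg[OF less_imp_le[OF \<open>t < T\<close>]] absorb[OF \<open>t < T\<close>]
    proof eventually_elim
      case (elim \<omega>)
      have "S (Suc t) \<omega> \<le> (1 + (1 - \<alpha>) * r) * S t \<omega>" if "\<omega> \<in> B"
      proof (cases "S t \<omega> = 0")
        case False
        with elim have "0 < S t \<omega>" by simp
        then have "S (Suc t) \<omega> - S t \<omega> \<le> (1 - \<alpha>) * r * S t \<omega>"
          using that by (simp add: B_def pos_divide_le_eq)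
        then show ?thesis by (simp add: distrib_right)
      qed (use elim in simp)
      with elim show ?case by (auto simp: indicator_def)
    qed
    then have "(\<integral>\<omega>. indicator A \<omega> * indicator B \<omega> \<partial>P) = (0 :: real)"
      by (simp add: integral_eq_zero_AE)
    \<comment> \<open>As \<open>A\<close> belongs to \<open>F t\<close>, the indicator of
      \<open>B\<close> may be replaced by its conditional probability, whose positivity then forces
      \<open>A\<close> to be null.\<close>
    then have "(\<integral>\<omega>. indicator A \<omega> * real_cond_exp P (F t) (indicator B) \<omega> \<partial>P) = 0"
      using cond(2) by simp
    moreover have "AE \<omega> in P. 0 \<le> indicator A \<omega> * real_cond_exp P (F t) (indicator B) \<omega>"
      using pos by eventually_elim (simp add: indicator_def)
    ultimately have "AE \<omega> in P. indicator A \<omega> * real_cond_exp P (F t) (indicator B) \<omega> = 0"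
      using integral_nonneg_eq_0_iff_AE[OF cond(1)] by simp
    with pos show ?thesis
      by eventually_elim (auto simp: indicator_def split: if_splits)
  qed
  interpret taxed_market P F T S r \<alpha>
    using assms(2,3,5-7) S_meas_F S_nonneg absorb down
    by unfold_locales (auto simp: filtration_def)
  show ?thesis
    using attainable_closed exists_separating_measure unfolding growth_def by blast
qed

end
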